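(* Let $(M,g)$ be an $n$-dimensional ($n>3$) weakly $Z$ symmetric manifold $(WZS)_n$ with non singular $Z$ tensor. Suppose $M$ is $K$-recurrent with closed $\lambda_i$, i.e. $\nabla_iK_{jkl}{}^m=\lambda_iK_{jkl}{}^m$ for some non zero covector $\lambda_i$ that is a closed 1-form, where $K$ is one of the tensors $C$ (conformal), $P$ (projective), $\tilde C$ (concircular), $N$ (conharmonic), $W$ (quasi conformal). Then $\omega_k=A_k-B_k$ is a closed 1-form.
   Context: $(M,g)$ is an $n$-dimensional Riemannian manifold with Levi-Civita connection $\nabla$; index notation with summation over repeated indices; $R_{jkl}{}^m$ is the Riemann tensor, $R_{kl}=-R_{mkl}{}^m$ the Ricci tensor, $R=g^{ij}R_{ij}$ the scalar curvature. Generalized $Z$ tensor: $Z_{kl}=R_{kl}+\phi\,g_{kl}$, where $\phi$ is an arbitrary scalar function. The manifold is weakly $Z$ symmetric, $(WZS)_n$, if for some $\phi$ there are covectors $A_k,B_k,D_k$ with $$\nabla_kZ_{jl}=A_kZ_{jl}+B_jZ_{kl}+D_lZ_{kj}.$$ The $Z$ tensor is non singular if there is a $(2,0)$ tensor $Z^{-1}$ with $(Z^{-1})^{kh}Z_{kl}=\delta^h{}_l$. A 1-form $\omega_k$ is closed if $\nabla_i\omega_j-\nabla_j\omega_i=0$. Curvature tensors: $$C_{jkl}{}^m=R_{jkl}{}^m+\tfrac{1}{n-2}(\delta_j{}^mR_{kl}-\delta_k{}^mR_{jl}+R_j{}^mg_{kl}-R_k{}^mg_{jl})-\tfrac{R}{(n-1)(n-2)}(\delta_j{}^mg_{kl}-\delta_k{}^mg_{jl}),$$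 $$P_{jkl}{}^m=R_{jkl}{}^m+\tfrac{1}{n-1}(\delta_j{}^mR_{kl}-\delta_k{}^mR_{jl}),$$ $$\tilde C_{jkl}{}^m=R_{jkl}{}^m+\tfrac{R}{n(n-1)}(\delta_j{}^mg_{kl}-\delta_k{}^mg_{jl}),$$ $$N_{jkl}{}^m=R_{jkl}{}^m+\tfrac{1}{n-2}(\delta_j{}^mR_{kl}-\delta_k{}^mR_{jl}+R_j{}^mg_{kl}-R_k{}^mg_{jl}),$$ $$W_{jkl}{}^m=-(n-2)\,b\,C_{jkl}{}^m+[a+(n-2)b]\,\tilde C_{jkl}{}^m,$$ with $a,b$ nonzero constants. *)

theory Defs
  imports "HOL-Analysis.Analysis"
begin

section \<open>Smooth manifolds\<close>

definition partial_deriv :: "'n::finite \<Rightarrow> (real^'n \<Rightarrow> real) \<Rightarrow> real^'n \<Rightarrow> real" where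
  "partial_deriv i f u = frechet_derivative f (at u) (axis i 1)"

primrec Ck_on :: "nat \<Rightarrow> (real^'n::finite) set \<Rightarrow> (real^'n \<Rightarrow> real) \<Rightarrow> bool" where
  "Ck_on 0 S f \<longleftrightarrow> continuous_on S f"
| "Ck_on (Suc k) S f \<longleftrightarrow> f differentiable_on S \<and> (\<forall>i. Ck_on k S (partial_deriv i f))"

text \<open>Only used for open \<open>S\<close>.\<close>

definition smooth_on :: "(real^'n::finite) set \<Rightarrow> (real^'n \<Rightarrow> real) \<Rightarrow> bool" where
  "smooth_on S f \<longleftrightarrow> (\<forall>k. Ck_on k S f)"

text \<open>A chart is a pair \<open>(U, x)\<close> of a domain and a coordinate map; the values of \<open>x\<close> outside \<open>U\<close>
  are irrelevant. The dimension of the manifold is \<open>CARD('n)\<close>.\<close>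

type_synonym ('a, 'n) chart = "'a set \<times> ('a \<Rightarrow> real^'n)"

definition smooth_atlas :: "'a topology \<Rightarrow> ('a, 'n::finite) chart set \<Rightarrow> bool" where
  "smooth_atlas X \<A> \<longleftrightarrow>
     topspace X = (\<Union>(U, x)\<in>\<A>. U) \<and>
     (\<forall>(U, x)\<in>\<A>. openin X U \<and> open (x ` U) \<and>
        homeomorphic_map (subtopology X U) (top_of_set (x ` U)) x) \<and>
     (\<forall>(U, x)\<in>\<A>. \<forall>(V, y)\<in>\<A>. \<forall>i.
        smooth_on (x ` (U \<inter> V)) (\<lambda>u. y (inv_into U x u) $ i))"

definition smooth_manifold :: "'a topology \<Rightarrow> ('a, 'n::finite) chart set \<Rightarrow> bool" where
  "smooth_manifold X \<A> \<longleftrightarrow> Hausdorff_space X \<and> second_countable X \<and> smooth_atlas X \<A>"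


section \<open>Tensor fields\<close>

text \<open>Tensor fields are given classically, by their components in every chart of the atlas, as
  functions of the coordinates, subject to the transformation law on overlaps.
  \<open>jacobian (U, x) (V, y) p a j\<close> is \<open>\<partial>x\<^sup>a/\<partial>y\<^sup>j\<close> at \<open>p \<in> U \<inter> V\<close>.\<close>

definition jacobian :: "('a, 'n::finite) chart \<Rightarrow> ('a, 'n) chart \<Rightarrow> 'a \<Rightarrow> 'n \<Rightarrow> 'n \<Rightarrow> real" where
  "jacobian c d p a j =
     partial_deriv j (\<lambda>v. snd c (inv_into (fst d) (snd d) v) $ a) (snd d p)"

definition scalar_field :: "('a, 'n::finite) chart set \<Rightarrow> ('a \<Rightarrow> real) \<Rightarrow> bool" where
  "scalar_field \<A> f \<longleftrightarrow> (\<forall>(U, x)\<in>\<A>. smooth_on (x ` U) (\<lambda>u. f (inv_into U x u)))"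

definition covector_field ::
  "('a, 'n::finite) chart set \<Rightarrow> (('a, 'n) chart \<Rightarrow> real^'n \<Rightarrow> real^'n) \<Rightarrow> bool" where
  "covector_field \<A> \<omega> \<longleftrightarrow>
     (\<forall>(U, x)\<in>\<A>. \<forall>i. smooth_on (x ` U) (\<lambda>u. \<omega> (U, x) u $ i)) \<and>
     (\<forall>(U, x)\<in>\<A>. \<forall>(V, y)\<in>\<A>. \<forall>p\<in>U \<inter> V. \<forall>j.
        \<omega> (V, y) (y p) $ j = (\<Sum>a\<in>UNIV. jacobian (U, x) (V, y) p a j * \<omega> (U, x) (x p) $ a))"

definition tensor_field_0_2 ::
  "('a, 'n::finite) chart set \<Rightarrow> (('a, 'n) chart \<Rightarrow> real^'n \<Rightarrow> real^'n^'n) \<Rightarrow> bool" where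
  "tensor_field_0_2 \<A> T \<longleftrightarrow>
     (\<forall>(U, x)\<in>\<A>. \<forall>i j. smooth_on (x ` U) (\<lambda>u. T (U, x) u $ i $ j)) \<and>
     (\<forall>(U, x)\<in>\<A>. \<forall>(V, y)\<in>\<A>. \<forall>p\<in>U \<inter> V. \<forall>i j.
        T (V, y) (y p) $ i $ j =
          (\<Sum>a\<in>UNIV. \<Sum>b\<in>UNIV.
             jacobian (U, x) (V, y) p a i * jacobian (U, x) (V, y) p b j * T (U, x) (x p) $ a $ b))"

definition tensor_field_2_0 ::
  "('a, 'n::finite) chart set \<Rightarrow> (('a, 'n) chart \<Rightarrow> real^'n \<Rightarrow> real^'n^'n) \<Rightarrow> bool" where
  "tensor_field_2_0 \<A> T \<longleftrightarrow>
     (\<forall>(U, x)\<in>\<A>. \<forall>i j. smooth_on (x ` U) (\<lambda>u. T (U, x) u $ i $ j)) \<and>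
     (\<forall>(U, x)\<in>\<A>. \<forall>(V, y)\<in>\<A>. \<forall>p\<in>U \<inter> V. \<forall>i j.
        T (V, y) (y p) $ i $ j =
          (\<Sum>a\<in>UNIV. \<Sum>b\<in>UNIV.
             jacobian (V, y) (U, x) p i a * jacobian (V, y) (U, x) p j b * T (U, x) (x p) $ a $ b))"

definition riemannian_manifold ::
  "'a topology \<Rightarrow> ('a, 'n::finite) chart set \<Rightarrow> (('a, 'n) chart \<Rightarrow> real^'n \<Rightarrow> real^'n^'n) \<Rightarrow> bool"
  where
  "riemannian_manifold X \<A> g \<longleftrightarrow>
     smooth_manifold X \<A> \<and> tensor_field_0_2 \<A> g \<and>
     (\<forall>(U, x)\<in>\<A>. \<forall>u\<in>x ` U.
        transpose (g (U, x) u) = g (U, x) u \<and> (\<forall>v. v \<noteq> 0 \<longrightarrow> v \<bullet> (g (U, x) u *v v) > 0))"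


section \<open>Levi-Civita connection and curvature in a chart\<close>

text \<open>Below, \<open>g\<close> is the metric in the coordinates of one chart.
  \<open>christoffel g u m i j\<close> is \<open>\<Gamma>\<^sup>m\<^sub>i\<^sub>j\<close>.\<close>

definition christoffel :: "(real^'n::finite \<Rightarrow> real^'n^'n) \<Rightarrow> real^'n \<Rightarrow> 'n \<Rightarrow> 'n \<Rightarrow> 'n \<Rightarrow> real" where
  "christoffel g u m i j =
     (1/2) * (\<Sum>l\<in>UNIV. matrix_inv (g u) $ m $ l *
        (partial_deriv i (\<lambda>v. g v $ j $ l) u + partial_deriv j (\<lambda>v. g v $ i $ l) u
         - partial_deriv l (\<lambda>v. g v $ i $ j) u))"

text \<open>In each covariant derivative the first index is the one of differentiation.\<close>

definition cov_deriv_covector ::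
  "(real^'n::finite \<Rightarrow> real^'n^'n) \<Rightarrow> (real^'n \<Rightarrow> real^'n) \<Rightarrow> real^'n \<Rightarrow> 'n \<Rightarrow> 'n \<Rightarrow> real" where
  "cov_deriv_covector g \<omega> u i j =
     partial_deriv i (\<lambda>v. \<omega> v $ j) u - (\<Sum>p\<in>UNIV. christoffel g u p i j * \<omega> u $ p)"

definition cov_deriv_0_2 ::
  "(real^'n::finite \<Rightarrow> real^'n^'n) \<Rightarrow> (real^'n \<Rightarrow> real^'n^'n) \<Rightarrow> real^'n \<Rightarrow> 'n \<Rightarrow> 'n \<Rightarrow> 'n \<Rightarrow> real"
  where
  "cov_deriv_0_2 g T u k j l =
     partial_deriv k (\<lambda>v. T v $ j $ l) u
     - (\<Sum>p\<in>UNIV. christoffel g u p k j * T u $ p $ l)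
     - (\<Sum>p\<in>UNIV. christoffel g u p k l * T u $ j $ p)"

text \<open>Tensors of type (1,3): \<open>K u j k l m\<close> stands for \<open>K\<^sub>j\<^sub>k\<^sub>l\<^sup>m\<close>.\<close>

type_synonym 'n tensor_1_3 = "real^'n \<Rightarrow> 'n \<Rightarrow> 'n \<Rightarrow> 'n \<Rightarrow> 'n \<Rightarrow> real"

definition cov_deriv_1_3 ::
  "(real^'n::finite \<Rightarrow> real^'n^'n) \<Rightarrow> 'n tensor_1_3 \<Rightarrow> real^'n \<Rightarrow> 'n \<Rightarrow> 'n \<Rightarrow> 'n \<Rightarrow> 'n \<Rightarrow> 'n \<Rightarrow> real"
  where
  "cov_deriv_1_3 g K u i j k l m =
     partial_deriv i (\<lambda>v. K v j k l m) u
     - (\<Sum>p\<in>UNIV. christoffel g u p i j * K u p k l m)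
     - (\<Sum>p\<in>UNIV. christoffel g u p i k * K u j p l m)
     - (\<Sum>p\<in>UNIV. christoffel g u p i l * K u j k p m)
     + (\<Sum>p\<in>UNIV. christoffel g u m i p * K u j k l p)"

text \<open>Sign convention: \<open>\<nabla>\<^sub>j\<nabla>\<^sub>k\<omega>\<^sub>l - \<nabla>\<^sub>k\<nabla>\<^sub>j\<omega>\<^sub>l = R\<^sub>j\<^sub>k\<^sub>l\<^sup>m \<omega>\<^sub>m\<close>. Together with
  \<open>R\<^sub>k\<^sub>l = - R\<^sub>m\<^sub>k\<^sub>l\<^sup>m\<close> this makes the Ricci tensor of the round sphere positive.\<close>

definition riemann :: "(real^'n::finite \<Rightarrow> real^'n^'n) \<Rightarrow> 'n tensor_1_3" where
  "riemann g u j k l m =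
     partial_deriv k (\<lambda>v. christoffel g v m j l) u - partial_deriv j (\<lambda>v. christoffel g v m k l) u
     + (\<Sum>p\<in>UNIV. christoffel g u m k p * christoffel g u p j l
                 - christoffel g u m j p * christoffel g u p k l)"

definition ricci :: "(real^'n::finite \<Rightarrow> real^'n^'n) \<Rightarrow> real^'n \<Rightarrow> real^'n^'n" where
  "ricci g u = (\<chi> k l. - (\<Sum>m\<in>UNIV. riemann g u m k l m))"

text \<open>\<open>ricci_mixed g u j m\<close> is \<open>R\<^sub>j\<^sup>m\<close>.\<close>

definition ricci_mixed :: "(real^'n::finite \<Rightarrow> real^'n^'n) \<Rightarrow> real^'n \<Rightarrow> 'n \<Rightarrow> 'n \<Rightarrow> real" where
  "ricci_mixed g u j m = (\<Sum>p\<in>UNIV. matrix_inv (g u) $ m $ p * ricci g u $ j $ p)"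

definition scalar_curv :: "(real^'n::finite \<Rightarrow> real^'n^'n) \<Rightarrow> real^'n \<Rightarrow> real" where
  "scalar_curv g u = (\<Sum>i\<in>UNIV. \<Sum>j\<in>UNIV. matrix_inv (g u) $ i $ j * ricci g u $ i $ j)"

definition kdelta :: "'n \<Rightarrow> 'n \<Rightarrow> real" where
  "kdelta i j = (if i = j then 1 else 0)"

definition conformal :: "(real^'n::finite \<Rightarrow> real^'n^'n) \<Rightarrow> 'n tensor_1_3" where
  "conformal g u j k l m =
     riemann g u j k l m
     + 1 / (real CARD('n) - 2) *
         (kdelta j m * ricci g u $ k $ l - kdelta k m * ricci g u $ j $ l
          + ricci_mixed g u j m * g u $ k $ l - ricci_mixed g u k m * g u $ j $ l)
     - scalar_curv g u / ((real CARD('n) - 1) * (real CARD('n) - 2)) *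
         (kdelta j m * g u $ k $ l - kdelta k m * g u $ j $ l)"

definition projective :: "(real^'n::finite \<Rightarrow> real^'n^'n) \<Rightarrow> 'n tensor_1_3" where
  "projective g u j k l m =
     riemann g u j k l m
     + 1 / (real CARD('n) - 1) *
         (kdelta j m * ricci g u $ k $ l - kdelta k m * ricci g u $ j $ l)"

definition concircular :: "(real^'n::finite \<Rightarrow> real^'n^'n) \<Rightarrow> 'n tensor_1_3" where
  "concircular g u j k l m =
     riemann g u j k l m
     + scalar_curv g u / (real CARD('n) * (real CARD('n) - 1)) *
         (kdelta j m * g u $ k $ l - kdelta k m * g u $ j $ l)"

definition conharmonic :: "(real^'n::finite \<Rightarrow> real^'n^'n) \<Rightarrow> 'n tensor_1_3" where
  "conharmonic g u j k l m =
     riemann g u j k l m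
     + 1 / (real CARD('n) - 2) *
         (kdelta j m * ricci g u $ k $ l - kdelta k m * ricci g u $ j $ l
          + ricci_mixed g u j m * g u $ k $ l - ricci_mixed g u k m * g u $ j $ l)"

definition quasi_conformal ::
  "real \<Rightarrow> real \<Rightarrow> (real^'n::finite \<Rightarrow> real^'n^'n) \<Rightarrow> 'n tensor_1_3" where
  "quasi_conformal a b g u j k l m =
     - (real CARD('n) - 2) * b * conformal g u j k l m
     + (a + (real CARD('n) - 2) * b) * concircular g u j k l m"


section \<open>Weakly Z symmetric and recurrent manifolds\<close>

text \<open>The generalized Z tensor in the chart \<open>(U, x)\<close>; \<open>\<phi>\<close> is a function on the manifold.\<close>

definition Z_tensor ::
  "(('a, 'n::finite) chart \<Rightarrow> real^'n \<Rightarrow> real^'n^'n) \<Rightarrow> ('a \<Rightarrow> real) \<Rightarrow>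
     ('a, 'n) chart \<Rightarrow> real^'n \<Rightarrow> real^'n^'n" where
  "Z_tensor g \<phi> = (\<lambda>(U, x) u. ricci (g (U, x)) u + \<phi> (inv_into U x u) *\<^sub>R g (U, x) u)"

definition weakly_Z_symmetric ::
  "('a, 'n::finite) chart set \<Rightarrow> (('a, 'n) chart \<Rightarrow> real^'n \<Rightarrow> real^'n^'n) \<Rightarrow> ('a \<Rightarrow> real) \<Rightarrow>
     (('a, 'n) chart \<Rightarrow> real^'n \<Rightarrow> real^'n) \<Rightarrow> (('a, 'n) chart \<Rightarrow> real^'n \<Rightarrow> real^'n) \<Rightarrow>
     (('a, 'n) chart \<Rightarrow> real^'n \<Rightarrow> real^'n) \<Rightarrow> bool" where
  "weakly_Z_symmetric \<A> g \<phi> A B D \<longleftrightarrow>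
     scalar_field \<A> \<phi> \<and> covector_field \<A> A \<and> covector_field \<A> B \<and> covector_field \<A> D \<and>
     (\<forall>(U, x)\<in>\<A>. \<forall>u\<in>x ` U. \<forall>k j l.
        cov_deriv_0_2 (g (U, x)) (Z_tensor g \<phi> (U, x)) u k j l =
          A (U, x) u $ k * Z_tensor g \<phi> (U, x) u $ j $ l
          + B (U, x) u $ j * Z_tensor g \<phi> (U, x) u $ k $ l
          + D (U, x) u $ l * Z_tensor g \<phi> (U, x) u $ k $ j)"

definition Z_nonsingular ::
  "('a, 'n::finite) chart set \<Rightarrow> (('a, 'n) chart \<Rightarrow> real^'n \<Rightarrow> real^'n^'n) \<Rightarrow> ('a \<Rightarrow> real) \<Rightarrow> bool"
  where
  "Z_nonsingular \<A> g \<phi> \<longleftrightarrow>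
     (\<exists>Zi. tensor_field_2_0 \<A> Zi \<and>
        (\<forall>(U, x)\<in>\<A>. \<forall>u\<in>x ` U. \<forall>h l.
           (\<Sum>k\<in>UNIV. Zi (U, x) u $ k $ h * Z_tensor g \<phi> (U, x) u $ k $ l) = kdelta h l))"

definition closed_1_form ::
  "('a, 'n::finite) chart set \<Rightarrow> (('a, 'n) chart \<Rightarrow> real^'n \<Rightarrow> real^'n^'n) \<Rightarrow>
     (('a, 'n) chart \<Rightarrow> real^'n \<Rightarrow> real^'n) \<Rightarrow> bool" where
  "closed_1_form \<A> g \<omega> \<longleftrightarrow>
     covector_field \<A> \<omega> \<and>
     (\<forall>(U, x)\<in>\<A>. \<forall>u\<in>x ` U. \<forall>i j.
        cov_deriv_covector (g (U, x)) (\<omega> (U, x)) u i j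
        - cov_deriv_covector (g (U, x)) (\<omega> (U, x)) u j i = 0)"

text \<open>\<open>K\<close> is the curvature tensor built from the metric, e.g. \<open>conformal\<close>. The recurrence
  covector is only required not to vanish identically; it may have zeros.\<close>

definition recurrent ::
  "('a, 'n::finite) chart set \<Rightarrow> (('a, 'n) chart \<Rightarrow> real^'n \<Rightarrow> real^'n^'n) \<Rightarrow>
     ((real^'n \<Rightarrow> real^'n^'n) \<Rightarrow> 'n tensor_1_3) \<Rightarrow>
     (('a, 'n) chart \<Rightarrow> real^'n \<Rightarrow> real^'n) \<Rightarrow> bool" where
  "recurrent \<A> g K \<Lambda> \<longleftrightarrow>
     covector_field \<A> \<Lambda> \<and>
     (\<exists>(U, x)\<in>\<A>. \<exists>u\<in>x ` U. \<Lambda> (U, x) u \<noteq> 0) \<and>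
     (\<forall>(U, x)\<in>\<A>. \<forall>u\<in>x ` U. \<forall>i j k l m.
        cov_deriv_1_3 (g (U, x)) (K (g (U, x))) u i j k l m
          = \<Lambda> (U, x) u $ i * K (g (U, x)) u j k l m)"

end

theory Submission
  imports Defs
begin

text \<open>
  Write \<open>\<omega> = A - B\<close>. Symmetry and nonsingularity of \<open>Z\<close> force \<open>D = B\<close>, so that
  \<open>\<nabla>\<^sub>kZ\<^sub>j\<^sub>l = A\<^sub>kZ\<^sub>j\<^sub>l + B\<^sub>jZ\<^sub>k\<^sub>l + B\<^sub>lZ\<^sub>k\<^sub>j\<close>. Commuting two covariant derivatives gives
  \<open>R\<^sub>i\<^sub>k\<^sub>j\<^sup>pZ\<^sub>p\<^sub>l + R\<^sub>i\<^sub>k\<^sub>l\<^sup>pZ\<^sub>p\<^sub>j = (dA)\<^sub>i\<^sub>k Z\<^sub>j\<^sub>l + M\<^sub>i\<^sub>jZ\<^sub>k\<^sub>l - M\<^sub>k\<^sub>jZ\<^sub>i\<^sub>l + M\<^sub>i\<^sub>lZ\<^sub>k\<^sub>j - M\<^sub>k\<^sub>lZ\<^sub>i\<^sub>j\<close>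
  with \<open>M\<^sub>i\<^sub>j = \<nabla>\<^sub>iB\<^sub>j - B\<^sub>iB\<^sub>j\<close>. At a point, choose a \<open>g\<close>-orthogonal basis of eigenvectors of \<open>Z\<close> relative
  to \<open>g\<close>. Inserting an eigenvector \<open>e\<close> for both \<open>j\<close> and \<open>l\<close> kills the left-hand side, because the
  curvature is skew with respect to \<open>g\<close>. Evaluating the indices \<open>i\<close>, \<open>k\<close> at two basis vectors different from
  \<open>e\<close> gives \<open>dA = 0\<close>; taking \<open>e\<close> equal to one of them then shows that \<open>M\<close> is diagonal in this
  basis, hence symmetric, so that \<open>(dB)\<^sub>i\<^sub>j = M\<^sub>i\<^sub>j - M\<^sub>j\<^sub>i\<close> also vanishes.
\<close>

section \<open>Calculus of smooth functions\<close>

lemma partial_deriv_eq: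
  assumes "(f has_derivative f') (at u)"
  shows "partial_deriv i f u = f' (axis i 1)"
  using frechet_derivative_at[OF assms] by (simp add: partial_deriv_def)

text \<open>\<open>frechet_derivative\<close> is a choice among the derivatives at the point.
  Functions agreeing on a neighbourhood have the same derivatives there, so the chosen values agree
  even where neither function is differentiable.\<close>

lemma partial_deriv_cong:
  assumes "open S" "u \<in> S" "\<And>v. v \<in> S \<Longrightarrow> f v = h v"
  shows "partial_deriv i f u = partial_deriv i h u"
proof -
  have "(f has_derivative D) (at u) \<longleftrightarrow> (h has_derivative D) (at u)" for D
    using has_derivative_transform_within_open[of f D u UNIV S h]
      has_derivative_transform_within_open[of h D u UNIV S f] assms by auto
  then show ?thesis by (simp add: partial_deriv_def frechet_derivative_def)
qed

lemma partial_deriv_const [simp]: "partial_deriv i (\<lambda>v. c) u = 0"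
  by (simp add: partial_deriv_eq[OF has_derivative_const])

lemma partial_deriv_add:
  assumes "f differentiable (at u)" "h differentiable (at u)"
  shows "partial_deriv i (\<lambda>v. f v + h v) u = partial_deriv i f u + partial_deriv i h u"
proof -
  from assms obtain f' h' where "(f has_derivative f') (at u)" "(h has_derivative h') (at u)"
    unfolding differentiable_def by blast
  then show ?thesis
    by (simp add: partial_deriv_eq partial_deriv_eq[OF has_derivative_add])
qed

lemma partial_deriv_mult:
  assumes "f differentiable (at u)" "h differentiable (at u)"
  shows "partial_deriv i (\<lambda>v. f v * h v) u = partial_deriv i f u * h u + f u * partial_deriv i h u"
proof -
  from assms obtain f' h' where "(f has_derivative f') (at u)" "(h has_derivative h') (at u)"
    unfolding differentiable_def by blast
  then show ?thesis
    by (simp add: partial_deriv_eq partial_deriv_eq[OF has_derivative_mult])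
qed

lemma partial_deriv_diff:
  assumes "f differentiable (at u)" "h differentiable (at u)"
  shows "partial_deriv i (\<lambda>v. f v - h v) u = partial_deriv i f u - partial_deriv i h u"
proof -
  from assms obtain f' h' where "(f has_derivative f') (at u)" "(h has_derivative h') (at u)"
    unfolding differentiable_def by blast
  then show ?thesis
    by (simp add: partial_deriv_eq partial_deriv_eq[OF has_derivative_diff])
qed

lemma partial_deriv_sum:
  assumes "finite I" "\<And>p. p \<in> I \<Longrightarrow> f p differentiable (at u)"
  shows "partial_deriv i (\<lambda>v. \<Sum>p\<in>I. f p v) u = (\<Sum>p\<in>I. partial_deriv i (f p) u)"
  using assms by (induction I rule: finite_induct) (simp_all add: partial_deriv_add differentiable_sum)

lemma partial_deriv_inverse:
  assumes "f differentiable (at u)" "f u \<noteq> 0"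
  shows "partial_deriv i (\<lambda>v. inverse (f v)) u = - (partial_deriv i f u * (inverse (f u) * inverse (f u)))"
proof -
  from assms obtain f' where "(f has_derivative f') (at u)"
    unfolding differentiable_def by blast
  with Deriv.has_derivative_inverse[OF assms(2) this] show ?thesis
    by (simp add: partial_deriv_eq)
qed

text \<open>Restriction to a coordinate line by the chain rule; this makes the mean value theorem in
  one variable applicable.\<close>

lemma partial_deriv_has_real_derivative:
  assumes "f differentiable (at (w + x *\<^sub>R axis i 1))"
  shows "((\<lambda>s. f (w + s *\<^sub>R axis i 1)) has_real_derivative partial_deriv i f (w + x *\<^sub>R axis i 1)) (at x)"
proof -
  obtain f' where f': "(f has_derivative f') (at (w + x *\<^sub>R axis i 1))"
    using assms unfolding differentiable_def by blast
  then interpret bounded_linear f' by (rule has_derivative_bounded_linear)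
  have "((\<lambda>s. w + s *\<^sub>R axis i 1) has_derivative (\<lambda>s. s *\<^sub>R axis i 1)) (at x)"
    by (auto intro!: derivative_eq_intros)
  from has_derivative_compose[OF this f'] show ?thesis
    by (simp add: has_field_derivative_def partial_deriv_eq[OF f'] scaleR mult_commute_abs)
qed

section \<open>Arithmetic of \<open>Ck_on\<close> and of smooth functions\<close>

text \<open>The rules for derivatives of sums, products and inverses hold only on \<open>S\<close>.
  Since \<open>S\<close> is open, agreement there is enough to transfer regularity from the formula
  to the derivative itself.\<close>

lemma Ck_on_cong:
  assumes "open S" "\<And>v. v \<in> S \<Longrightarrow> f v = h v"
  shows "Ck_on k S f \<longleftrightarrow> Ck_on k S h"
  using assms(2)
proof (induction k arbitrary: f h)
  case 0
  then show ?case using continuous_on_cong[OF refl] by auto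
next
  case (Suc k)
  have "f differentiable_on S \<longleftrightarrow> h differentiable_on S"
    using Suc.prems differentiable_transform_within[OF _ zero_less_one, of f _ S h]
      differentiable_transform_within[OF _ zero_less_one, of h _ S f]
    unfolding differentiable_on_def by metis
  moreover have "Ck_on k S (partial_deriv i f) \<longleftrightarrow> Ck_on k S (partial_deriv i h)" for i
    using Suc.prems by (intro Suc.IH partial_deriv_cong[OF assms(1)]) auto
  ultimately show ?case by simp
qed

text \<open>In the product and quotient rules the undifferentiated factors must be lowered by one
  order before the induction hypothesis applies.\<close>

lemma Ck_on_SucD: "Ck_on (Suc k) S f \<Longrightarrow> Ck_on k S f"
proof (induction k arbitrary: f)
  case 0
  then show ?case by (simp add: differentiable_imp_continuous_on)
next
  case (Suc k)
  then have "Ck_on (Suc k) S (partial_deriv i f)" for i by simp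
  then have "Ck_on k S (partial_deriv i f)" for i by (rule Suc.IH)
  with Suc.prems show ?case by simp
qed

lemma Ck_on_const: "Ck_on k S (\<lambda>v. c)"
proof (induction k arbitrary: c)
  case (Suc k)
  have "partial_deriv i (\<lambda>v. c) = (\<lambda>v. 0)" for i :: 'a by auto
  with Suc show ?case by simp
qed simp

lemma Ck_on_add:
  assumes "open S" "Ck_on k S f" "Ck_on k S h"
  shows "Ck_on k S (\<lambda>v. f v + h v)"
  using assms(2,3)
proof (induction k arbitrary: f h)
  case (Suc k)
  have d: "f differentiable (at v)" "h differentiable (at v)" if "v \<in> S" for v
    using Suc.prems that differentiable_on_eq_differentiable_at[OF assms(1)] by auto
  have "Ck_on k S (partial_deriv i (\<lambda>v. f v + h v))" for i
  proof -
    have "Ck_on k S (\<lambda>v. partial_deriv i f v + partial_deriv i h v)"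
      using Suc.prems by (intro Suc.IH) auto
    then show ?thesis
      by (rule iffD2[OF Ck_on_cong[OF assms(1)], rotated]) (rule partial_deriv_add[OF d])
  qed
  then show ?case using Suc.prems by simp
qed (simp add: continuous_on_add)

lemma Ck_on_mult:
  assumes "open S" "Ck_on k S f" "Ck_on k S h"
  shows "Ck_on k S (\<lambda>v. f v * h v)"
  using assms(2,3)
proof (induction k arbitrary: f h)
  case (Suc k)
  have d: "f differentiable (at v)" "h differentiable (at v)" if "v \<in> S" for v
    using Suc.prems that differentiable_on_eq_differentiable_at[OF assms(1)] by auto
  have "Ck_on k S (partial_deriv i (\<lambda>v. f v * h v))" for i
  proof -
    have "Ck_on k S (\<lambda>v. partial_deriv i f v * h v + f v * partial_deriv i h v)"
      using Suc.prems Ck_on_SucD[OF Suc.prems(1)] Ck_on_SucD[OF Suc.prems(2)]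
      by (intro Ck_on_add[OF assms(1)] Suc.IH) (simp_all only: Ck_on.simps)
    then show ?thesis
      by (rule iffD2[OF Ck_on_cong[OF assms(1)], rotated]) (rule partial_deriv_mult[OF d])
  qed
  then show ?case using Suc.prems by simp
qed (simp add: continuous_on_mult)

text \<open>The derivative of \<open>1/f\<close> is a product of a derivative of \<open>f\<close>
  with two copies of \<open>1/f\<close>, so regularity of order \<open>k\<close> of
  \<open>1/f\<close> itself yields order \<open>k + 1\<close>.\<close>

lemma Ck_on_inverse:
  assumes "open S" "Ck_on k S f" "\<And>v. v \<in> S \<Longrightarrow> f v \<noteq> 0"
  shows "Ck_on k S (\<lambda>v. inverse (f v))"
  using assms(2)
proof (induction k)
  case (Suc k)
  have d: "f differentiable (at v)" if "v \<in> S" for v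
    using Suc.prems that differentiable_on_eq_differentiable_at[OF assms(1)] by auto
  have inv: "Ck_on k S (\<lambda>v. inverse (f v))" using Suc.IH Ck_on_SucD[OF Suc.prems] .
  have "Ck_on k S (partial_deriv i (\<lambda>v. inverse (f v)))" for i
  proof -
    have "Ck_on k S (partial_deriv i f)" using Suc.prems by simp
    from Ck_on_mult[OF assms(1) Ck_on_const[of k S "-1"]
        Ck_on_mult[OF assms(1) this Ck_on_mult[OF assms(1) inv inv]]]
    have "Ck_on k S (\<lambda>v. - (partial_deriv i f v * (inverse (f v) * inverse (f v))))" by simp
    then show ?thesis
      by (rule iffD2[OF Ck_on_cong[OF assms(1)], rotated]) (rule partial_deriv_inverse[OF d assms(3)])
  qed
  then show ?case using Suc.prems assms(3) by simp
qed (use assms(3) in \<open>simp add: continuous_on_inverse\<close>)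

lemma smooth_on_cong:
  assumes "open S" "\<And>v. v \<in> S \<Longrightarrow> f v = h v"
  shows "smooth_on S f \<longleftrightarrow> smooth_on S h"
  using Ck_on_cong[OF assms] by (simp add: smooth_on_def)

lemma smooth_on_const: "smooth_on S (\<lambda>v. c)"
  by (simp add: smooth_on_def Ck_on_const)

lemma smooth_on_add: "open S \<Longrightarrow> smooth_on S f \<Longrightarrow> smooth_on S h \<Longrightarrow> smooth_on S (\<lambda>v. f v + h v)"
  unfolding smooth_on_def by (intro allI Ck_on_add) auto

lemma smooth_on_mult: "open S \<Longrightarrow> smooth_on S f \<Longrightarrow> smooth_on S h \<Longrightarrow> smooth_on S (\<lambda>v. f v * h v)"
  unfolding smooth_on_def by (intro allI Ck_on_mult) auto

lemma smooth_on_minus: "open S \<Longrightarrow> smooth_on S f \<Longrightarrow> smooth_on S (\<lambda>v. - f v)"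
  using smooth_on_mult[OF _ smooth_on_const[of S "-1"], of f] by simp

lemma smooth_on_diff: "open S \<Longrightarrow> smooth_on S f \<Longrightarrow> smooth_on S h \<Longrightarrow> smooth_on S (\<lambda>v. f v - h v)"
  using smooth_on_add[of S f "\<lambda>v. - h v"] smooth_on_minus[of S h] by simp

lemma smooth_on_divide:
  assumes "open S" "smooth_on S f" "smooth_on S h" "\<And>v. v \<in> S \<Longrightarrow> h v \<noteq> 0"
  shows "smooth_on S (\<lambda>v. f v / h v)"
  using assms unfolding smooth_on_def divide_inverse by (intro allI Ck_on_mult Ck_on_inverse) auto

lemma smooth_on_sum:
  assumes "open S" "\<And>p. p \<in> I \<Longrightarrow> smooth_on S (f p)"
  shows "smooth_on S (\<lambda>v. \<Sum>p\<in>I. f p v)"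
  using assms(2) by (induction I rule: infinite_finite_induct)
    (auto intro: smooth_on_const smooth_on_add[OF assms(1)])

lemma smooth_on_prod:
  assumes "open S" "\<And>p. p \<in> I \<Longrightarrow> smooth_on S (f p)"
  shows "smooth_on S (\<lambda>v. \<Prod>p\<in>I. f p v)"
  using assms(2) by (induction I rule: infinite_finite_induct)
    (auto intro: smooth_on_const smooth_on_mult[OF assms(1)])

lemma smooth_on_partial_deriv: "smooth_on S f \<Longrightarrow> smooth_on S (partial_deriv i f)"
  unfolding smooth_on_def
proof
  fix k assume "\<forall>k. Ck_on k S f"
  then have "Ck_on (Suc k) S f" ..
  then show "Ck_on k S (partial_deriv i f)" by simp
qed

lemma smooth_on_differentiable:
  assumes "open S" "smooth_on S f" "u \<in> S"
  shows "f differentiable (at u)"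
proof -
  have "Ck_on (Suc 0) S f" using assms(2) by (simp add: smooth_on_def)
  then show ?thesis using assms differentiable_on_eq_differentiable_at[OF assms(1)] by auto
qed

section \<open>Determinants and inverses of matrices with smooth entries\<close>

lemma smooth_on_det:
  fixes M :: "real^'n::finite \<Rightarrow> real^'m::finite^'m"
  assumes "open S" "\<And>i j. smooth_on S (\<lambda>v. M v $ i $ j)"
  shows "smooth_on S (\<lambda>v. det (M v))"
  unfolding det_def using assms
  by (intro smooth_on_sum smooth_on_mult smooth_on_const smooth_on_prod) auto

text \<open>Column \<open>l\<close> of the inverse solves \<open>A x = axis l 1\<close>, so Cramer's
  rule applies. A quotient of determinants is visibly smooth in the entries of
  \<open>A\<close>.\<close>

lemma matrix_inv_cramer:
  fixes A :: "real^'n::finite^'n"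
  assumes "invertible A"
  shows "matrix_inv A $ m $ l = det (\<chi> i j. if j = m then axis l 1 $ i else A $ i $ j) / det A"
proof -
  have "A ** matrix_inv A = mat 1"
    using someI_ex[OF assms[unfolded invertible_def]] by (simp add: matrix_inv_def)
  then have "A *v column l (matrix_inv A) = column l (mat 1)"
    by (metis matrix_vector_mul_assoc matrix_vector_mult_basis)
  also have "\<dots> = axis l 1"
    by (simp add: column_def mat_def axis_def vec_eq_iff)
  finally have col: "A *v column l (matrix_inv A) = axis l 1" .
  have "det (\<chi> i j. if j = m then axis l 1 $ i else A $ i $ j) = column l (matrix_inv A) $ m * det A"
    using cramer_lemma[of m A "column l (matrix_inv A)"] unfolding col .
  moreover have "det A \<noteq> 0" using assms invertible_det_nz by blast
  ultimately show ?thesis by (simp add: column_def)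
qed

lemma smooth_on_matrix_inv:
  fixes M :: "real^'n::finite \<Rightarrow> real^'m::finite^'m"
  assumes "open S" "\<And>i j. smooth_on S (\<lambda>v. M v $ i $ j)" "\<And>v. v \<in> S \<Longrightarrow> invertible (M v)"
  shows "smooth_on S (\<lambda>v. matrix_inv (M v) $ m $ l)"
proof -
  have *: "smooth_on S (\<lambda>v. if j = m then axis l 1 $ i else M v $ i $ j)" for i j
    using assms(2) by (cases "j = m") (auto intro: smooth_on_const)
  have "smooth_on S (\<lambda>v. det (\<chi> i j. if j = m then axis l 1 $ i else M v $ i $ j) / det (M v))"
    using assms * by (intro smooth_on_divide smooth_on_det) (auto simp: invertible_det_nz)
  then show ?thesis
    by (subst smooth_on_cong[OF assms(1) matrix_inv_cramer[OF assms(3)]])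
qed

section \<open>Equality of mixed second partial derivatives\<close>

text \<open>The second difference is a difference in direction \<open>i\<close> of differences in
  direction \<open>k\<close>. The mean value theorem is applied first along \<open>i\<close>, then
  along \<open>k\<close> to the resulting first derivative.\<close>

lemma second_difference_mean_value:
  fixes f :: "real^'n::finite \<Rightarrow> real"
  assumes S: "open S" and f: "Ck_on 2 S f" and h: "h > 0"
    and sub: "\<And>s t. 0 \<le> s \<Longrightarrow> s \<le> h \<Longrightarrow> 0 \<le> t \<Longrightarrow> t \<le> h \<Longrightarrow> u + s *\<^sub>R axis i 1 + t *\<^sub>R axis k 1 \<in> S"
  obtains s t where "0 < s" "s < h" "0 < t" "t < h"
    "f (u + h *\<^sub>R axis i 1 + h *\<^sub>R axis k 1) - f (u + h *\<^sub>R axis i 1) - f (u + h *\<^sub>R axis k 1) + f u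
      = h * h * partial_deriv k (partial_deriv i f) (u + s *\<^sub>R axis i 1 + t *\<^sub>R axis k 1)"
proof -
  have f2: "f differentiable_on S" "\<And>i. partial_deriv i f differentiable_on S"
    using f by (auto simp: numeral_2_eq_2)
  have d: "f differentiable (at v)" "partial_deriv i f differentiable (at v)" if "v \<in> S" for v i
    using f2 that differentiable_on_eq_differentiable_at[OF S] by auto
  let ?F = "\<lambda>s. f ((u + h *\<^sub>R axis k 1) + s *\<^sub>R axis i 1) - f (u + s *\<^sub>R axis i 1)"
  have "(?F has_real_derivative partial_deriv i f ((u + h *\<^sub>R axis k 1) + s *\<^sub>R axis i 1)
       - partial_deriv i f (u + s *\<^sub>R axis i 1)) (at s)" if "0 \<le> s" "s \<le> h" for s
    using sub[of s h] sub[of s 0] that h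
    by (intro DERIV_diff partial_deriv_has_real_derivative d) (auto simp: algebra_simps)
  from MVT2[OF h this] obtain s where s: "0 < s" "s < h"
    "?F h - ?F 0 = h * (partial_deriv i f ((u + h *\<^sub>R axis k 1) + s *\<^sub>R axis i 1)
       - partial_deriv i f (u + s *\<^sub>R axis i 1))" by auto
  have "((\<lambda>t. partial_deriv i f ((u + s *\<^sub>R axis i 1) + t *\<^sub>R axis k 1)) has_real_derivative
      partial_deriv k (partial_deriv i f) ((u + s *\<^sub>R axis i 1) + t *\<^sub>R axis k 1)) (at t)"
    if "0 \<le> t" "t \<le> h" for t
    using sub[of s t] that s by (intro partial_deriv_has_real_derivative d) auto
  from MVT2[OF h this] obtain t where t: "0 < t" "t < h"
    "partial_deriv i f ((u + s *\<^sub>R axis i 1) + h *\<^sub>R axis k 1) - partial_deriv i f (u + s *\<^sub>R axis i 1)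
      = h * partial_deriv k (partial_deriv i f) ((u + s *\<^sub>R axis i 1) + t *\<^sub>R axis k 1)" by auto
  show thesis
  proof (rule that[OF s(1,2) t(1,2)])
    have "?F h - ?F 0 = h * (h * partial_deriv k (partial_deriv i f) ((u + s *\<^sub>R axis i 1) + t *\<^sub>R axis k 1))"
      using s(3) t(3) by (simp add: ac_simps)
    then show "f (u + h *\<^sub>R axis i 1 + h *\<^sub>R axis k 1) - f (u + h *\<^sub>R axis i 1) - f (u + h *\<^sub>R axis k 1) + f u
      = h * h * partial_deriv k (partial_deriv i f) (u + s *\<^sub>R axis i 1 + t *\<^sub>R axis k 1)"
      by (simp add: algebra_simps)
  qed
qed

text \<open>The second difference does not change when \<open>i\<close> and \<open>k\<close> are
  exchanged. Hence the two mixed derivatives take a common value at points arbitrarily close to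
  \<open>u\<close>, and continuity carries the equality to \<open>u\<close>.\<close>

lemma partial_deriv_commute:
  fixes f :: "real^'n::finite \<Rightarrow> real"
  assumes S: "open S" and f: "Ck_on 2 S f" and u: "u \<in> S"
  shows "partial_deriv i (partial_deriv k f) u = partial_deriv k (partial_deriv i f) u"
proof (rule ccontr)
  let ?P = "partial_deriv i (partial_deriv k f)" and ?Q = "partial_deriv k (partial_deriv i f)"
  assume ne: "?P u \<noteq> ?Q u"
  \<comment> \<open>Half of the gap: two errors below \<open>e\<close> cannot bridge it.\<close>
  define e where "e = dist (?P u) (?Q u) / 2"
  have e: "e > 0" using ne by (simp add: e_def)
  have "continuous_on S ?P" "continuous_on S ?Q" using f by (auto simp: numeral_2_eq_2)
  then have "isCont ?P u" "isCont ?Q u" using S u by (auto simp: continuous_on_eq_continuous_at)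
  then obtain d1 d2 where d1: "d1 > 0" "\<And>v. dist v u < d1 \<Longrightarrow> dist (?P v) (?P u) < e"
    and d2: "d2 > 0" "\<And>v. dist v u < d2 \<Longrightarrow> dist (?Q v) (?Q u) < e"
    unfolding continuous_at_eps_delta using e by metis
  obtain d3 where d3: "d3 > 0" "ball u d3 \<subseteq> S" using S u openE by blast
  \<comment> \<open>Two displacements of length at most \<open>h\<close> stay strictly inside all
    three radii.\<close>
  define h where "h = min d1 (min d2 d3) / 3"
  have h: "h > 0" using d1 d2 d3 by (simp add: h_def)
  have near: "dist (u + s *\<^sub>R axis a 1 + t *\<^sub>R axis b 1) u < min d1 (min d2 d3)"
    if "0 \<le> s" "s \<le> h" "0 \<le> t" "t \<le> h" for s t a b
  proof -
    have "dist (u + s *\<^sub>R axis a 1 + t *\<^sub>R axis b 1) u \<le> norm (s *\<^sub>R axis a (1::real)) + norm (t *\<^sub>R axis b (1::real) :: real^'n)"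
      using norm_triangle_ineq[of "s *\<^sub>R axis a (1::real)" "t *\<^sub>R axis b (1::real) :: real^'n"]
      by (simp add: dist_norm)
    also have "\<dots> \<le> h + h" using that by simp
    also have "\<dots> < min d1 (min d2 d3)" using h unfolding h_def by linarith
    finally show ?thesis .
  qed
  have inS: "u + s *\<^sub>R axis a 1 + t *\<^sub>R axis b 1 \<in> S"
    if "0 \<le> s" "s \<le> h" "0 \<le> t" "t \<le> h" for s t a b
    using near[OF that, of a b] d3 by (auto simp: mem_ball dist_commute subset_iff)
  obtain s t where st: "0 < s" "s < h" "0 < t" "t < h"
    "f (u + h *\<^sub>R axis i 1 + h *\<^sub>R axis k 1) - f (u + h *\<^sub>R axis i 1) - f (u + h *\<^sub>R axis k 1) + f u
      = h * h * ?Q (u + s *\<^sub>R axis i 1 + t *\<^sub>R axis k 1)"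
    using second_difference_mean_value[OF S f h inS] .
  obtain s' t' where st': "0 < s'" "s' < h" "0 < t'" "t' < h"
    "f (u + h *\<^sub>R axis k 1 + h *\<^sub>R axis i 1) - f (u + h *\<^sub>R axis k 1) - f (u + h *\<^sub>R axis i 1) + f u
      = h * h * ?P (u + s' *\<^sub>R axis k 1 + t' *\<^sub>R axis i 1)"
    using second_difference_mean_value[OF S f h inS] .
  have swap: "u + h *\<^sub>R axis k 1 + h *\<^sub>R axis i 1 = u + h *\<^sub>R axis i 1 + h *\<^sub>R axis k 1"
    by (simp add: add_ac)
  have "h * h * ?P (u + s' *\<^sub>R axis k 1 + t' *\<^sub>R axis i 1) = h * h * ?Q (u + s *\<^sub>R axis i 1 + t *\<^sub>R axis k 1)"
    using st(5) st'(5)[unfolded swap] by linarith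
  then have "?P (u + s' *\<^sub>R axis k 1 + t' *\<^sub>R axis i 1) = ?Q (u + s *\<^sub>R axis i 1 + t *\<^sub>R axis k 1)"
    using h by simp
  moreover have "dist (?P (u + s' *\<^sub>R axis k 1 + t' *\<^sub>R axis i 1)) (?P u) < e"
    using near[of s' t' k i] st' by (intro d1) auto
  moreover have "dist (?Q (u + s *\<^sub>R axis i 1 + t *\<^sub>R axis k 1)) (?Q u) < e"
    using near[of s t i k] st by (intro d2) auto
  ultimately have "dist (?P u) (?Q u) < dist (?P u) (?Q u)"
    unfolding e_def by (metis dist_triangle_half_r)
  then show False by simp
qed


section \<open>Simultaneous diagonalization\<close>

lemma nonneg_quadratic_linear_coeff_zero:
  fixes b c :: real
  assumes "\<And>t. 0 \<le> 2 * t * b + t * t * c"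
  shows "b = 0"
proof (rule ccontr)
  assume b: "b \<noteq> 0"
  \<comment> \<open>The minimizer of the upper bound
    \<open>2 * t * b + t * t * (\<bar>c\<bar> + 1)\<close>; adding 1 keeps the denominator positive
    when \<open>c\<close> vanishes.\<close>
  define t where "t = - b / (\<bar>c\<bar> + 1)"
  have tb: "t * (\<bar>c\<bar> + 1) = - b" by (simp add: t_def)
  have "t * t * c \<le> t * t * (\<bar>c\<bar> + 1)" by (intro mult_left_mono) auto
  also have "\<dots> = - (t * b)" using tb by (simp add: mult.assoc)
  finally have "0 \<le> t * b" using assms[of t] by simp
  moreover have "t * b = - (b * b / (\<bar>c\<bar> + 1))" by (simp add: t_def)
  moreover have "b * b / (\<bar>c\<bar> + 1) > 0" using b by (intro divide_pos_pos) (auto simp: zero_less_mult_iff)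
  ultimately show False by simp
qed

lemma symmetric_matrix_inner:
  fixes M :: "real^'n::finite^'n"
  assumes "transpose M = M"
  shows "x \<bullet> (M *v y) = y \<bullet> (M *v x)"
  by (metis assms dot_lmul_matrix inner_commute vector_transpose_matrix)

text \<open>The form is nonnegative along \<open>v + t w\<close>. Its constant term in
  \<open>t\<close> is zero, so the linear coefficient must vanish too.\<close>

lemma psd_isotropic_orthogonal:
  fixes H :: "real^'n::finite^'n"
  assumes "transpose H = H" "subspace V" "\<And>x. x \<in> V \<Longrightarrow> 0 \<le> x \<bullet> (H *v x)"
    "v \<in> V" "v \<bullet> (H *v v) = 0" "w \<in> V"
  shows "w \<bullet> (H *v v) = 0"
proof (rule nonneg_quadratic_linear_coeff_zero)
  fix t
  have "v + t *\<^sub>R w \<in> V" using assms by (simp add: subspace_add subspace_scale)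
  then have "0 \<le> (v + t *\<^sub>R w) \<bullet> (H *v (v + t *\<^sub>R w))" by (rule assms(3))
  also have "\<dots> = 2 * t * (w \<bullet> (H *v v)) + t * t * (w \<bullet> (H *v w))"
    using assms(5) symmetric_matrix_inner[OF assms(1), of v w]
    by (simp add: matrix_vector_right_distrib matrix_vector_mult_scaleR inner_add algebra_simps)
  finally show "0 \<le> 2 * t * (w \<bullet> (H *v v)) + t * t * (w \<bullet> (H *v w))" .
qed

section \<open>Eigenvectors of \<open>Z\<close> relative to \<open>G\<close>\<close>

text \<open>A maximizer \<open>v\<close> of the Rayleigh quotient on the \<open>G\<close>-orthogonal
  complement \<open>V\<close> of \<open>E\<close> is isotropic for \<open>H\<close>, which is
  nonnegative on \<open>V\<close>. So \<open>H v\<close> is orthogonal to \<open>V\<close>; it is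
  orthogonal to \<open>E\<close> because the elements of \<open>E\<close> are eigenvectors. As
  \<open>V\<close> and \<open>E\<close> span the space, \<open>H v = 0\<close>.\<close>

lemma next_generalized_eigenvector:
  fixes G Z :: "real^'n::finite^'n"
  assumes G: "transpose G = G" "\<And>v. v \<noteq> 0 \<Longrightarrow> v \<bullet> (G *v v) > 0"
    and Z: "transpose Z = Z"
    and E: "finite E" "card E < CARD('n)" "0 \<notin> E" "\<And>e. e \<in> E \<Longrightarrow> \<exists>z. Z *v e = z *\<^sub>R (G *v e)"
      "pairwise (\<lambda>a b. a \<bullet> (G *v b) = 0) E"
  shows "\<exists>v z. v \<noteq> 0 \<and> Z *v v = z *\<^sub>R (G *v v) \<and> (\<forall>e\<in>E. e \<bullet> (G *v v) = 0)"
proof -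
  define V where "V = {v. \<forall>e\<in>E. e \<bullet> (G *v v) = 0}"
  have V: "subspace V"
    by (auto simp: V_def subspace_def matrix_vector_right_distrib matrix_vector_mult_scaleR inner_add_right)
  \<comment> \<open>Fewer than \<open>CARD('n)\<close> linear conditions define \<open>V\<close>, so
    it contains a nonzero vector.\<close>
  have "dim ((*v) G ` E) \<le> card ((*v) G ` E)" using E by (intro dim_le_card') auto
  also have "\<dots> < DIM(real^'n)" using E card_image_le[of E "(*v) G"] by simp
  finally obtain x where x: "x \<noteq> 0" "\<And>y. y \<in> span ((*v) G ` E) \<Longrightarrow> orthogonal x y"
    using orthogonal_to_subspace_exists by blast
  have xV: "x \<in> V"
    using x(2)[OF span_base] symmetric_matrix_inner[OF G(1), of _ x] by (simp add: V_def orthogonal_def)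
  \<comment> \<open>The quotient is invariant under scaling, so it suffices to maximize over the
    compact unit sphere of \<open>V\<close>.\<close>
  let ?K = "sphere 0 1 \<inter> V"
  let ?f = "\<lambda>v. v \<bullet> (Z *v v) / (v \<bullet> (G *v v))"
  have f: "?f v * (v \<bullet> (G *v v)) = v \<bullet> (Z *v v)" for v using G(2)[of v] by (cases "v = 0") auto
  have "compact ?K" using closed_subspace[OF V] by (simp add: compact_Int_closed)
  moreover have "x /\<^sub>R norm x \<in> ?K" using x(1) xV V by (auto simp: subspace_scale)
  moreover have "continuous_on ?K ?f"
    using G(2) by (intro continuous_intros matrix_vector_mult_linear_continuous_on ballI)
      (metis Int_iff less_irrefl mem_sphere_0 norm_zero zero_neq_one)
  ultimately obtain v where v: "v \<in> ?K" "\<And>w. w \<in> ?K \<Longrightarrow> ?f w \<le> ?f v"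
    using continuous_attains_sup[of ?K ?f] by blast
  define H where "H = ?f v *\<^sub>R G - Z"
  have H: "transpose H = H" using G(1) Z by (simp add: H_def transpose_def vec_eq_iff)
  have Hq: "H *v w = ?f v *\<^sub>R (G *v w) - Z *v w" for w
    by (simp add: H_def matrix_vector_mult_diff_rdistrib scaleR_matrix_vector_assoc)
  have H0: "v \<bullet> (H *v v) = 0" using f[of v] by (simp add: Hq inner_diff_right)
  have Hpos: "0 \<le> w \<bullet> (H *v w)" if w: "w \<in> V" for w
  proof (cases "w = 0")
    case False
    have "?f (w /\<^sub>R norm w) \<le> ?f v" using False w V by (intro v) (auto simp: subspace_scale)
    also have "?f (w /\<^sub>R norm w) = ?f w"
      using False by (simp add: matrix_vector_mult_scaleR)
    finally have "?f w * (w \<bullet> (G *v w)) \<le> ?f v * (w \<bullet> (G *v w))"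
      using G(2)[OF False] by (intro mult_right_mono) auto
    then show ?thesis using f[of w] by (simp add: Hq inner_diff_right)
  qed simp
  have vV: "v \<in> V" "v \<noteq> 0" using v(1) by auto
  have He: "e \<bullet> (H *v v) = 0" if e: "e \<in> E" for e
  proof -
    obtain z where z: "Z *v e = z *\<^sub>R (G *v e)" using E(4) e by blast
    have "e \<bullet> (G *v v) = 0" using vV e by (simp add: V_def)
    moreover have "e \<bullet> (Z *v v) = z * (e \<bullet> (G *v v))"
      using symmetric_matrix_inner[OF Z, of e v] symmetric_matrix_inner[OF G(1), of e v] z by simp
    ultimately show ?thesis by (simp add: Hq inner_diff_right)
  qed
  have "w \<bullet> (H *v v) = 0" for w
  proof -
    \<comment> \<open>Coefficients of the \<open>G\<close>-orthogonal projection of \<open>w\<close>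
      to the span of \<open>E\<close>; the remainder lies in \<open>V\<close>.\<close>
    define c where "c e = (e \<bullet> (G *v w)) / (e \<bullet> (G *v e))" for e
    let ?p = "\<Sum>e\<in>E. c e *\<^sub>R e"
    have "a \<bullet> (G *v ?p) = a \<bullet> (G *v w)" if a: "a \<in> E" for a
    proof -
      have "a \<bullet> (G *v ?p) = (\<Sum>e\<in>E. c e * (a \<bullet> (G *v e)))"
        by (simp add: vec.linear_sum matrix_vector_mult_scaleR inner_sum_right
            linear_sum[OF matrix_vector_mul_linear])
      also have "\<dots> = (\<Sum>e\<in>E. if e = a then c a * (a \<bullet> (G *v a)) else 0)"
        using E(5) a by (intro sum.cong) (auto simp: pairwise_def)
      also have "\<dots> = c a * (a \<bullet> (G *v a))" using E(1) a by simp
      also have "\<dots> = a \<bullet> (G *v w)" using G(2)[of a] E(3) a by (cases "a = 0") (auto simp: c_def)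
      finally show ?thesis .
    qed
    then have "w - ?p \<in> V" by (simp add: V_def matrix_vector_mult_diff_distrib inner_diff_right)
    then have "(w - ?p) \<bullet> (H *v v) = 0" using psd_isotropic_orthogonal[OF H V Hpos vV(1) H0] by blast
    moreover have "?p \<bullet> (H *v v) = 0" by (simp add: inner_sum_left He)
    ultimately show ?thesis by (simp add: inner_diff_left)
  qed
  then have "H *v v = 0" using inner_eq_zero_iff by blast
  then have "Z *v v = ?f v *\<^sub>R (G *v v)" by (simp add: Hq)
  with vV show ?thesis unfolding V_def by blast
qed

text \<open>Eigenvectors are added one at a time until there are \<open>CARD('n)\<close> of them.
  Nonzero \<open>G\<close>-orthogonal vectors are independent, so by counting they span.\<close>

lemma simultaneous_diagonalization:
  fixes G Z :: "real^'n::finite^'n"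
  assumes G: "transpose G = G" "\<And>v. v \<noteq> 0 \<Longrightarrow> v \<bullet> (G *v v) > 0"
    and Z: "transpose Z = Z"
  obtains E where "finite E" "card E = CARD('n)" "span E = UNIV" "0 \<notin> E"
    "\<And>e. e \<in> E \<Longrightarrow> \<exists>z. Z *v e = z *\<^sub>R (G *v e)"
    "\<And>a b. a \<in> E \<Longrightarrow> b \<in> E \<Longrightarrow> a \<noteq> b \<Longrightarrow> a \<bullet> (G *v b) = 0"
proof -
  have "\<exists>E. finite E \<and> card E = k \<and> 0 \<notin> E \<and> (\<forall>e\<in>E. \<exists>z. Z *v e = z *\<^sub>R (G *v e)) \<and>
      pairwise (\<lambda>a b. a \<bullet> (G *v b) = 0) E" if "k \<le> CARD('n)" for k
    using that
  proof (induction k)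
    case 0
    show ?case by (rule exI[of _ "{}"]) (auto simp: pairwise_def)
  next
    case (Suc k)
    then obtain E where E: "finite E" "card E = k" "0 \<notin> E" "\<forall>e\<in>E. \<exists>z. Z *v e = z *\<^sub>R (G *v e)"
      "pairwise (\<lambda>a b. a \<bullet> (G *v b) = 0) E" by auto
    then obtain v where v: "v \<noteq> 0" "\<exists>z. Z *v v = z *\<^sub>R (G *v v)" "\<forall>e\<in>E. e \<bullet> (G *v v) = 0"
      using next_generalized_eigenvector[OF G Z, of E] Suc.prems by auto
    have "v \<notin> E" using v G(2)[of v] by force
    moreover have "\<forall>e\<in>E. v \<bullet> (G *v e) = 0" using v(3) symmetric_matrix_inner[OF G(1)] by metis
    ultimately show ?case using E v
      by (intro exI[of _ "insert v E"]) (auto simp: pairwise_insert)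
  qed
  then obtain E where E: "finite E" "card E = CARD('n)" "0 \<notin> E" "\<forall>e\<in>E. \<exists>z. Z *v e = z *\<^sub>R (G *v e)"
      "pairwise (\<lambda>a b. a \<bullet> (G *v b) = 0) E" by blast
  have "independent E"
  proof
    assume "dependent E"
    then obtain c a where ca: "(\<Sum>e\<in>E. c e *\<^sub>R e) = 0" "a \<in> E" "c a \<noteq> (0::real)"
      using dependent_finite[OF E(1)] by auto
    have "0 = (\<Sum>e\<in>E. c e *\<^sub>R e) \<bullet> (G *v a)" using ca by simp
    also have "\<dots> = (\<Sum>e\<in>E. if e = a then c a * (a \<bullet> (G *v a)) else 0)"
      unfolding inner_sum_left using E(5) ca(2) by (intro sum.cong) (auto simp: pairwise_def)
    also have "\<dots> = c a * (a \<bullet> (G *v a))" using E(1) ca by simp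
    finally show False using ca(2,3) E(3) G(2)[of a] by fastforce
  qed
  then have "span E = UNIV" using E independent_explicit card_eq_dim[of E UNIV]
    by (simp add: top.extremum_unique dim_UNIV)
  then show thesis using that E unfolding pairwise_def by blast
qed


section \<open>Curvature identities in a chart\<close>

text \<open>Contraction of both free indices with \<open>e\<close>. The two transposed copies of
  \<open>P\<close> contribute equally, as do the two pairs of rank-one terms.\<close>

lemma quadratic_contraction:
  fixes e m n r s :: "real^'n::finite" and T P :: "real^'n^'n"
  assumes "\<And>j l. P $ j $ l + P $ l $ j
    = c * T $ j $ l + m $ j * s $ l - n $ j * r $ l + m $ l * s $ j - n $ l * r $ j"
  shows "2 * (e \<bullet> (P *v e)) = c * (e \<bullet> (T *v e)) + 2 * (m \<bullet> e) * (s \<bullet> e) - 2 * (n \<bullet> e) * (r \<bullet> e)"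
proof -
  \<comment> \<open>The contraction as a linear functional of the array \<open>F\<close>, invariant
    under transposition.\<close>
  define q where "q F = (\<Sum>j\<in>UNIV. \<Sum>l\<in>UNIV. F j l * (e $ j * e $ l))" for F :: "'n \<Rightarrow> 'n \<Rightarrow> real"
  have q_mat: "e \<bullet> (M *v e) = q (\<lambda>j l. M $ j $ l)" for M :: "real^'n^'n"
    by (simp add: q_def inner_vec_def matrix_vector_mult_def sum_distrib_left ac_simps)
  have q_add: "q (\<lambda>j l. F j l + H j l) = q F + q H" for F H
    by (simp add: q_def sum.distrib distrib_right)
  have q_diff: "q (\<lambda>j l. F j l - H j l) = q F - q H" for F H
    by (simp add: q_def sum_subtractf left_diff_distrib)
  have q_cmult: "q (\<lambda>j l. d * F j l) = d * q F" for F d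
    by (simp add: q_def sum_distrib_left mult.assoc)
  have q_prod: "q (\<lambda>j l. x $ j * y $ l) = (x \<bullet> e) * (y \<bullet> e)" for x y
    by (simp add: q_def inner_vec_def sum_product ac_simps)
  have q_swap: "q (\<lambda>j l. F l j) = q F" for F
    unfolding q_def by (subst sum.swap) (simp add: ac_simps)
  have "2 * (e \<bullet> (P *v e)) = q (\<lambda>j l. P $ j $ l + P $ l $ j)"
    unfolding q_mat q_add q_swap[of "\<lambda>j l. P $ j $ l"] by simp
  also have "\<dots> = q (\<lambda>j l. c * T $ j $ l + m $ j * s $ l - n $ j * r $ l + m $ l * s $ j - n $ l * r $ j)"
    by (simp only: assms)
  also have "\<dots> = c * (e \<bullet> (T *v e)) + 2 * (m \<bullet> e) * (s \<bullet> e) - 2 * (n \<bullet> e) * (r \<bullet> e)"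
    unfolding q_mat q_add q_diff q_cmult q_prod
      q_swap[of "\<lambda>j l. m $ j * s $ l"] q_swap[of "\<lambda>j l. n $ j * r $ l"] by simp
  finally show ?thesis .
qed

section \<open>Metric and connection in one coordinate domain\<close>

text \<open>The metric seen in a single chart, as a matrix-valued function on an open set of
  coordinates. The assertion to be proved is local, so all curvature computations take place
  here.\<close>

locale riemannian_chart =
  fixes S :: "(real^'n::finite) set" and G :: "real^'n \<Rightarrow> real^'n^'n"
  assumes open_S: "open S"
    and smooth_G: "smooth_on S (\<lambda>v. G v $ i $ j)"
    and sym_G: "v \<in> S \<Longrightarrow> transpose (G v) = G v"
    and pos_G: "v \<in> S \<Longrightarrow> w \<noteq> 0 \<Longrightarrow> w \<bullet> (G v *v w) > 0"
begin

lemma G_commute: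
  assumes "v \<in> S"
  shows "G v $ i $ j = G v $ j $ i"
proof -
  have "G v $ i $ j = transpose (G v) $ j $ i" by (simp add: transpose_def)
  then show ?thesis using sym_G[OF assms] by simp
qed

lemma invertible_G:
  assumes "v \<in> S"
  shows "invertible (G v)"
  unfolding invertible_left_inverse matrix_left_invertible_ker
proof (intro allI impI)
  fix w assume "G v *v w = 0"
  then show "w = 0" using pos_G[OF assms, of w] by force
qed

lemma G_matrix_inv: "v \<in> S \<Longrightarrow> G v ** matrix_inv (G v) = mat 1"
  using someI_ex[OF invertible_G[unfolded invertible_def]] by (simp add: matrix_inv_def)

lemma smooth_christoffel: "smooth_on S (\<lambda>v. christoffel G v m i j)"
  unfolding christoffel_def
  by (intro smooth_on_mult smooth_on_const smooth_on_sum smooth_on_add smooth_on_diff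
      smooth_on_matrix_inv smooth_on_partial_deriv smooth_G invertible_G open_S)

lemma smooth_riemann: "smooth_on S (\<lambda>v. riemann G v j k l m)"
  unfolding riemann_def
  by (intro smooth_on_mult smooth_on_sum smooth_on_add smooth_on_diff
      smooth_on_partial_deriv smooth_christoffel open_S)

lemma smooth_ricci: "smooth_on S (\<lambda>v. ricci G v $ k $ l)"
  unfolding ricci_def vec_lambda_beta
  by (intro smooth_on_minus smooth_on_sum smooth_riemann open_S)

lemma partial_deriv_G_commute:
  "u \<in> S \<Longrightarrow> partial_deriv k (\<lambda>v. G v $ i $ j) u = partial_deriv k (\<lambda>v. G v $ j $ i) u"
  by (rule partial_deriv_cong[OF open_S _ G_commute])

lemma christoffel_commute: "u \<in> S \<Longrightarrow> christoffel G u m i j = christoffel G u m j i"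
  by (simp add: christoffel_def partial_deriv_G_commute[of u _ i j] algebra_simps)

lemma partial_deriv_christoffel_commute:
  "u \<in> S \<Longrightarrow> partial_deriv k (\<lambda>v. christoffel G v m i j) u = partial_deriv k (\<lambda>v. christoffel G v m j i) u"
  by (rule partial_deriv_cong[OF open_S _ christoffel_commute])

text \<open>Contraction with \<open>G\<close> cancels the inverse matrix and leaves the Christoffel
  symbols of the first kind.\<close>

lemma christoffel_lower:
  assumes "u \<in> S"
  shows "(\<Sum>p\<in>UNIV. christoffel G u p k j * G u $ p $ l) =
    1/2 * (partial_deriv k (\<lambda>v. G v $ j $ l) u + partial_deriv j (\<lambda>v. G v $ k $ l) u
         - partial_deriv l (\<lambda>v. G v $ k $ j) u)"
proof -
  let ?c = "\<lambda>l. partial_deriv k (\<lambda>v. G v $ j $ l) u + partial_deriv j (\<lambda>v. G v $ k $ l) u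
         - partial_deriv l (\<lambda>v. G v $ k $ j) u"
  have inv: "(\<Sum>p\<in>UNIV. G u $ l $ p * matrix_inv (G u) $ p $ q) = (if l = q then 1 else 0)" for q
    using G_matrix_inv[OF assms] by (simp add: matrix_matrix_mult_def mat_def vec_eq_iff)
  have "(\<Sum>p\<in>UNIV. christoffel G u p k j * G u $ p $ l)
      = (\<Sum>p\<in>UNIV. \<Sum>q\<in>UNIV. 1/2 * (?c q * (G u $ l $ p * matrix_inv (G u) $ p $ q)))"
    by (simp add: christoffel_def sum_distrib_left sum_distrib_right G_commute[OF assms, of _ l] ac_simps)
  also have "\<dots> = 1/2 * (\<Sum>q\<in>UNIV. ?c q * (\<Sum>p\<in>UNIV. G u $ l $ p * matrix_inv (G u) $ p $ q))"
    by (subst sum.swap) (simp add: sum_distrib_left)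
  also have "\<dots> = 1/2 * ?c l" by (simp add: inv if_distrib cong: if_cong)
  finally show ?thesis .
qed

text \<open>Of the six metric derivatives in the two lowered symbols, four cancel and the remaining
  two add up to the partial derivative of \<open>G\<close>.\<close>

lemma metric_compatible:
  assumes "u \<in> S"
  shows "cov_deriv_0_2 G G u k j l = 0"
proof -
  have "(\<Sum>p\<in>UNIV. christoffel G u p k l * G u $ j $ p) = (\<Sum>p\<in>UNIV. christoffel G u p k l * G u $ p $ j)"
    by (simp add: G_commute[OF assms, of j])
  then show ?thesis
    by (simp add: cov_deriv_0_2_def christoffel_lower[OF assms] partial_deriv_G_commute[OF assms, of _ j l]
        partial_deriv_G_commute[OF assms, of _ k] field_simps)
qed

lemma cov_deriv_covector_antisym:
  assumes "u \<in> S"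
  shows "cov_deriv_covector G \<omega> u i k - cov_deriv_covector G \<omega> u k i
    = partial_deriv i (\<lambda>v. \<omega> v $ k) u - partial_deriv k (\<lambda>v. \<omega> v $ i) u"
  by (simp add: cov_deriv_covector_def christoffel_commute[OF assms, of _ i k])

section \<open>Commuting two derivatives of the tensor\<close>

text \<open>Mixed partial derivatives of \<open>T\<close> commute. Expressing them through
  \<open>weak\<close>, used twice, turns this into the Ricci identity for \<open>T\<close>. The
  quadratic term in \<open>M\<close> comes from the second use. The case \<open>T = G\<close> with
  zero covectors is also used, for the skewness of the curvature.\<close>

lemma weakly_symmetric_ricci_identity:
  assumes u: "u \<in> S"
    and T: "\<And>j l. smooth_on S (\<lambda>v. T v $ j $ l)"
    and T_commute: "\<And>v j l. v \<in> S \<Longrightarrow> T v $ j $ l = T v $ l $ j"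
    and a: "\<And>j. smooth_on S (\<lambda>v. a v $ j)" and b: "\<And>j. smooth_on S (\<lambda>v. b v $ j)"
    and weak: "\<And>v k j l. v \<in> S \<Longrightarrow> cov_deriv_0_2 G T v k j l
      = a v $ k * T v $ j $ l + b v $ j * T v $ k $ l + b v $ l * T v $ k $ j"
  defines "M \<equiv> \<lambda>i j. cov_deriv_covector G b u i j - b u $ i * b u $ j"
  shows "(\<Sum>p\<in>UNIV. riemann G u i k j p * T u $ p $ l) + (\<Sum>p\<in>UNIV. riemann G u i k l p * T u $ p $ j)
    = (cov_deriv_covector G a u i k - cov_deriv_covector G a u k i) * T u $ j $ l
      + M i j * T u $ k $ l - M k j * T u $ i $ l + M i l * T u $ k $ j - M k l * T u $ i $ j"
proof -
  define c where "c p k j = christoffel G u p k j" for p k j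
  define dc where "dc i p k j = partial_deriv i (\<lambda>v. christoffel G v p k j) u" for i p k j
  define t where "t j l = T u $ j $ l" for j l
  define dt where "dt i j l = partial_deriv i (\<lambda>v. T v $ j $ l) u" for i j l
  define da where "da i k = partial_deriv i (\<lambda>v. a v $ k) u" for i k
  define db where "db i k = partial_deriv i (\<lambda>v. b v $ k) u" for i k
  define L where "L k j l = (\<Sum>p\<in>UNIV. c p k j * t p l)" for k j l
  define Bc where "Bc k j = (\<Sum>p\<in>UNIV. c p k j * b u $ p)" for k j
  \<comment> \<open>\<open>Q1\<close> carries the quadratic part of the curvature and
    \<open>Y\<close> below its derivative part. \<open>Q2\<close> is invariant under exchanging
    \<open>i\<close> with \<open>k\<close> and \<open>j\<close> with \<open>l\<close> at once, so it
    drops out of the commutator.\<close>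
  define Q1 where "Q1 i k j l = (\<Sum>p\<in>UNIV. \<Sum>q\<in>UNIV. c p k j * (c q i p * t q l))" for i k j l
  define Q2 where "Q2 i k j l = (\<Sum>p\<in>UNIV. \<Sum>q\<in>UNIV. c p k j * (c q i l * t q p))" for i k j l
  define Y where "Y i k j l = (\<Sum>p\<in>UNIV. dc i p k j * t p l)" for i k j l
  note defs = c_def dc_def t_def dt_def da_def db_def

  have c_comm: "c p k j = c p j k" for p k j using christoffel_commute[OF u] by (simp add: c_def)
  have t_comm: "t j l = t l j" for j l using T_commute[OF u] by (simp add: t_def)
  have dt_comm: "dt i j l = dt i l j" for i j l
    unfolding dt_def by (rule partial_deriv_cong[OF open_S u T_commute])
  have L_comm: "L k j l = L j k l" for k j l by (simp add: L_def c_comm[of _ k j])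
  have Bc_comm: "Bc k j = Bc j k" for k j by (simp add: Bc_def c_comm[of _ k j])
  have Q2_comm: "Q2 i k j l = Q2 k i l j" for i k j l
    unfolding Q2_def by (subst sum.swap) (simp add: t_comm ac_simps)

  have first: "partial_deriv k (\<lambda>v. T v $ j $ l) v
      = (\<Sum>p\<in>UNIV. christoffel G v p k j * T v $ p $ l) + (\<Sum>p\<in>UNIV. christoffel G v p k l * T v $ p $ j)
        + a v $ k * T v $ j $ l + b v $ j * T v $ k $ l + b v $ l * T v $ k $ j" if "v \<in> S" for v k j l
    using weak[OF that, of k j l] by (simp add: cov_deriv_0_2_def T_commute[OF that, of j])
  have dt: "dt k j l = L k j l + L k l j + a u $ k * t j l + b u $ j * t k l + b u $ l * t k j" for k j l
    using first[OF u] by (simp add: L_def defs)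
  have diffs: "(\<lambda>v. christoffel G v p k j) differentiable (at u)" "(\<lambda>v. T v $ j $ l) differentiable (at u)"
    "(\<lambda>v. a v $ j) differentiable (at u)" "(\<lambda>v. b v $ j) differentiable (at u)" for p k j l
    using smooth_on_differentiable[OF open_S _ u] smooth_christoffel T a b by blast+
  \<comment> \<open>The equation holds on the whole open set \<open>S\<close> and may be
    differentiated. The first derivatives of \<open>T\<close> that appear are eliminated by
    \<open>contract\<close> and \<open>dt\<close>.\<close>
  have second: "partial_deriv i (partial_deriv k (\<lambda>v. T v $ j $ l)) u
      = (Y i k j l + (\<Sum>p\<in>UNIV. c p k j * dt i p l)) + (Y i k l j + (\<Sum>p\<in>UNIV. c p k l * dt i p j))
        + (da i k * t j l + a u $ k * dt i j l) + (db i j * t k l + b u $ j * dt i k l)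
        + (db i l * t k j + b u $ l * dt i k j)" for i k j l
    by (subst partial_deriv_cong[OF open_S u first], assumption)
      (simp add: partial_deriv_add partial_deriv_mult partial_deriv_sum diffs differentiable_add
        differentiable_mult differentiable_sum sum.distrib Y_def defs)
  have contract: "(\<Sum>p\<in>UNIV. c p k j * dt i p l)
      = Q1 i k j l + Q2 i k j l + a u $ i * L k j l + Bc k j * t i l + b u $ l * L k j i" for i k j l
  proof -
    have "(\<Sum>p\<in>UNIV. c p k j * dt i p l) = (\<Sum>p\<in>UNIV. c p k j * L i p l) + (\<Sum>p\<in>UNIV. c p k j * L i l p)
        + a u $ i * (\<Sum>p\<in>UNIV. c p k j * t p l) + (\<Sum>p\<in>UNIV. c p k j * b u $ p) * t i l
        + b u $ l * (\<Sum>p\<in>UNIV. c p k j * t p i)"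
      by (simp add: dt distrib_left sum.distrib sum_distrib_left sum_distrib_right t_comm[of i] ac_simps)
    then show ?thesis by (simp add: L_def[symmetric] Bc_def[symmetric])
        (simp add: L_def Q1_def Q2_def sum_distrib_left)
  qed
  have riem: "(\<Sum>p\<in>UNIV. riemann G u i k j p * T u $ p $ l) = Y k i j l - Y i k j l + Q1 k i j l - Q1 i k j l" for j l
  proof -
    have Q1: "(\<Sum>p\<in>UNIV. (\<Sum>q\<in>UNIV. c p k q * c q i j) * t p l) = Q1 k i j l" for i k
      unfolding Q1_def by (subst sum.swap) (simp add: sum_distrib_left ac_simps)
    have "(\<Sum>p\<in>UNIV. riemann G u i k j p * T u $ p $ l) = (\<Sum>p\<in>UNIV. dc k p i j * t p l) - (\<Sum>p\<in>UNIV. dc i p k j * t p l)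
       + (\<Sum>p\<in>UNIV. (\<Sum>q\<in>UNIV. c p k q * c q i j) * t p l) - (\<Sum>p\<in>UNIV. (\<Sum>q\<in>UNIV. c p i q * c q k j) * t p l)"
      by (simp add: riemann_def defs sum_subtractf sum.distrib left_diff_distrib distrib_right)
    then show ?thesis by (simp add: Q1 Y_def)
  qed
  have Mdef: "M i j = db i j - Bc i j - b u $ i * b u $ j" for i j
    by (simp add: M_def cov_deriv_covector_def Bc_def defs)
  have "Ck_on 2 S (\<lambda>v. T v $ j $ l)" using T by (simp add: smooth_on_def)
  from partial_deriv_commute[OF open_S this u]
  have commute: "partial_deriv k (partial_deriv i (\<lambda>v. T v $ j $ l)) u
      - partial_deriv i (partial_deriv k (\<lambda>v. T v $ j $ l)) u = 0" by simp
  have curl: "cov_deriv_covector G a u i k - cov_deriv_covector G a u k i = da i k - da k i"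
    using cov_deriv_covector_antisym[OF u] by (simp add: da_def)
  \<comment> \<open>Fixed instances choose one order for each symmetric pair of indices, after which
    the identity is purely polynomial.\<close>
  note normal = L_comm[of k i] Bc_comm[of k i] Q2_comm[of k i]
    t_comm[of l j] t_comm[of j k] t_comm[of l k] t_comm[of j i] t_comm[of l i] t_comm[of k i]
  have "(\<Sum>p\<in>UNIV. riemann G u i k j p * T u $ p $ l) + (\<Sum>p\<in>UNIV. riemann G u i k l p * T u $ p $ j)
      - ((cov_deriv_covector G a u i k - cov_deriv_covector G a u k i) * T u $ j $ l
        + M i j * T u $ k $ l - M k j * T u $ i $ l + M i l * T u $ k $ j - M k l * T u $ i $ j)
    = partial_deriv k (partial_deriv i (\<lambda>v. T v $ j $ l)) u
      - partial_deriv i (partial_deriv k (\<lambda>v. T v $ j $ l)) u"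
    unfolding second riem curl Mdef unfolding contract unfolding dt t_def[symmetric] unfolding normal
    by (simp add: algebra_simps)
  then show ?thesis unfolding commute by simp
qed

section \<open>Symmetries of the Riemann and Ricci tensors\<close>

lemma riemann_antisym: "riemann G u j k l m = - riemann G u k j l m"
  by (simp add: riemann_def sum_subtractf)

text \<open>The connection is torsion-free: once the lower indices of the Christoffel symbols are
  ordered, all terms cancel in pairs.\<close>

lemma riemann_cyclic:
  assumes "u \<in> S"
  shows "riemann G u j k l m + riemann G u k l j m + riemann G u l j k m = 0"
  by (simp add: riemann_def sum_subtractf christoffel_commute[OF assms, of _ k j]
      christoffel_commute[OF assms, of _ l j] christoffel_commute[OF assms, of _ l k]
      partial_deriv_christoffel_commute[OF assms, of _ _ k j]
      partial_deriv_christoffel_commute[OF assms, of _ _ l j]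
      partial_deriv_christoffel_commute[OF assms, of _ _ l k])

text \<open>The metric is parallel, so the Ricci identity applies to it with both covectors
  zero.\<close>

lemma riemann_skew:
  assumes "u \<in> S"
  shows "(\<Sum>p\<in>UNIV. riemann G u i k j p * G u $ p $ l) + (\<Sum>p\<in>UNIV. riemann G u i k l p * G u $ p $ j) = 0"
proof -
  have "(\<Sum>p\<in>UNIV. riemann G u i k j p * G u $ p $ l) + (\<Sum>p\<in>UNIV. riemann G u i k l p * G u $ p $ j)
    = (cov_deriv_covector G (\<lambda>v. 0) u i k - cov_deriv_covector G (\<lambda>v. 0) u k i) * G u $ j $ l"
    using weakly_symmetric_ricci_identity[OF assms smooth_G G_commute, of "\<lambda>v. 0" "\<lambda>v. 0" i k j l]
    by (simp add: metric_compatible smooth_on_const cov_deriv_covector_def)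
  then show ?thesis by (simp add: cov_deriv_covector_def)
qed

text \<open>With its last index lowered, the curvature is a skew matrix \<open>N ** G u\<close>.
  Moving \<open>G u\<close> to the other side shows that \<open>N\<close> is similar to
  \<open>- transpose N\<close>, so its trace equals its own negative.\<close>

lemma riemann_trace:
  assumes "u \<in> S"
  shows "(\<Sum>m\<in>UNIV. riemann G u i k m m) = 0"
proof -
  define N :: "real^'n^'n" where "N = (\<chi> j p. riemann G u i k j p)"
  have "N ** G u = - transpose (N ** G u)"
    using riemann_skew[OF assms, of i k]
    by (simp add: N_def vec_eq_iff matrix_matrix_mult_def transpose_def eq_neg_iff_add_eq_0)
  also have "\<dots> = - (G u ** transpose N)"
    by (simp add: matrix_transpose_mul sym_G[OF assms])
  finally have "N ** G u ** matrix_inv (G u) = - (G u ** transpose N) ** matrix_inv (G u)" by simp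
  then have "N = - (G u ** transpose N) ** matrix_inv (G u)"
    by (simp flip: matrix_mul_assoc add: G_matrix_inv[OF assms])
  then have "trace N = trace (- (G u ** transpose N) ** matrix_inv (G u))" by simp
  also have "\<dots> = - trace ((G u ** transpose N) ** matrix_inv (G u))"
    by (simp add: trace_def matrix_matrix_mult_def sum_negf)
  also have "trace ((G u ** transpose N) ** matrix_inv (G u)) = trace (transpose N ** matrix_inv (G u) ** G u)"
    by (metis matrix_mul_assoc trace_mul_sym)
  also have "transpose N ** matrix_inv (G u) ** G u = transpose N"
    using G_matrix_inv[OF assms] matrix_left_right_inverse[of "G u"]
    by (simp flip: matrix_mul_assoc)
  also have "trace (transpose N) = trace N" by (simp add: trace_def transpose_def)
  finally show ?thesis by (simp add: trace_def N_def)
qed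

text \<open>Contracting the cyclic identity expresses the skew part of the Ricci tensor by the trace
  that vanishes by \<open>riemann_trace\<close>.\<close>

lemma ricci_commute:
  assumes "u \<in> S"
  shows "ricci G u $ k $ l = ricci G u $ l $ k"
proof -
  have "ricci G u $ l $ k - ricci G u $ k $ l = (\<Sum>m\<in>UNIV. riemann G u m k l m + riemann G u l m k m)"
    by (simp add: ricci_def riemann_antisym[of u l] sum_subtractf)
  also have "\<dots> = (\<Sum>m\<in>UNIV. - riemann G u k l m m)"
    using riemann_cyclic[OF assms] by (intro sum.cong) (auto simp: eq_neg_iff_add_eq_0 algebra_simps)
  also have "\<dots> = 0" by (simp add: sum_negf riemann_trace[OF assms])
  finally show ?thesis by simp
qed

section \<open>Closedness of the difference covector in a chart\<close>

lemma weakly_symmetric_difference_closed: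
  assumes u: "u \<in> S" and dim: "CARD('n) \<ge> 3"
    and T: "\<And>j l. smooth_on S (\<lambda>v. T v $ j $ l)"
    and T_commute: "\<And>v j l. v \<in> S \<Longrightarrow> T v $ j $ l = T v $ l $ j"
    and T_ker: "\<And>w. T u *v w = 0 \<Longrightarrow> w = 0"
    and a: "\<And>j. smooth_on S (\<lambda>v. a v $ j)" and b: "\<And>j. smooth_on S (\<lambda>v. b v $ j)"
    and weak: "\<And>v k j l. v \<in> S \<Longrightarrow> cov_deriv_0_2 G T v k j l
      = a v $ k * T v $ j $ l + b v $ j * T v $ k $ l + b v $ l * T v $ k $ j"
  shows "cov_deriv_covector G (\<lambda>v. a v - b v) u i k - cov_deriv_covector G (\<lambda>v. a v - b v) u k i = 0"
proof -
  define dA :: "real^'n^'n" where "dA = (\<chi> i k. cov_deriv_covector G a u i k - cov_deriv_covector G a u k i)"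
  define M :: "real^'n^'n" where "M = (\<chi> i j. cov_deriv_covector G b u i j - b u $ i * b u $ j)"
  have T_sym: "transpose (T u) = T u" using T_commute[OF u] by (simp add: vec_eq_iff transpose_def)
  have dA_skew: "transpose dA = - dA" by (simp add: vec_eq_iff transpose_def dA_def)

  \<comment> \<open>The Ricci identity with \<open>e\<close> in the slots \<open>j\<close> and
    \<open>l\<close>, and \<open>x\<close>, \<open>y\<close> in the slots \<open>i\<close> and
    \<open>k\<close>.\<close>
  have eigen: "0 = (x \<bullet> (dA *v y)) * (e \<bullet> (T u *v e)) + 2 * (x \<bullet> (M *v e)) * (y \<bullet> (T u *v e))
      - 2 * (y \<bullet> (M *v e)) * (x \<bullet> (T u *v e))" if e: "T u *v e = z *\<^sub>R (G u *v e)" for e z x y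
  proof -
    have ik: "0 = dA $ i $ k * (e \<bullet> (T u *v e)) + 2 * (M *v e) $ i * (T u *v e) $ k
      - 2 * (M *v e) $ k * (T u *v e) $ i" for i k
    proof -
      define N :: "real^'n^'n" where "N = (\<chi> j p. riemann G u i k j p)"
      \<comment> \<open>Skewness is a contraction with zero right-hand side. As
        \<open>T u *v e\<close> is a multiple of \<open>G u *v e\<close>, the curvature term for
        \<open>T\<close> vanishes as well.\<close>
      have "2 * (e \<bullet> ((N ** G u) *v e)) = 0 * (e \<bullet> (T u *v e)) + 2 * (0 \<bullet> e) * (0 \<bullet> e) - 2 * (0 \<bullet> e) * (0 \<bullet> e)"
        using riemann_skew[OF u] by (intro quadratic_contraction) (simp add: N_def matrix_matrix_mult_def)
      then have "e \<bullet> ((N ** T u) *v e) = 0"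
        by (simp add: e matrix_vector_mult_scaleR flip: matrix_vector_mul_assoc)
      moreover have "2 * (e \<bullet> ((N ** T u) *v e)) = dA $ i $ k * (e \<bullet> (T u *v e))
          + 2 * (M $ i \<bullet> e) * (T u $ k \<bullet> e) - 2 * (M $ k \<bullet> e) * (T u $ i \<bullet> e)"
        using weakly_symmetric_ricci_identity[OF u T T_commute a b weak, of i k]
        by (intro quadratic_contraction) (simp add: N_def matrix_matrix_mult_def dA_def M_def)
      ultimately show ?thesis by (simp add: matrix_mult_dot)
    qed
    have xdA: "x \<bullet> (dA *v y) = (\<Sum>i\<in>UNIV. \<Sum>k\<in>UNIV. x $ i * (dA $ i $ k * y $ k))"
      by (simp add: inner_vec_def matrix_vector_mult_def sum_distrib_left)
    have "0 = (\<Sum>i\<in>UNIV. \<Sum>k\<in>UNIV. x $ i * y $ k * (dA $ i $ k * (e \<bullet> (T u *v e))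
        + 2 * (M *v e) $ i * (T u *v e) $ k - 2 * (M *v e) $ k * (T u *v e) $ i))"
      by (simp flip: ik)
    also have "\<dots> = (\<Sum>i\<in>UNIV. \<Sum>k\<in>UNIV. x $ i * (dA $ i $ k * y $ k)) * (e \<bullet> (T u *v e))
        + 2 * ((\<Sum>i\<in>UNIV. x $ i * (M *v e) $ i) * (\<Sum>k\<in>UNIV. y $ k * (T u *v e) $ k))
        - 2 * ((\<Sum>i\<in>UNIV. x $ i * (T u *v e) $ i) * (\<Sum>k\<in>UNIV. y $ k * (M *v e) $ k))"
      unfolding sum_product
      by (simp add: sum_distrib_left sum_distrib_right sum.distrib sum_subtractf algebra_simps)
    finally show ?thesis
      unfolding xdA by (simp add: inner_vec_def ac_simps)
  qed

  obtain E where E: "finite E" "card E = CARD('n)" "span E = UNIV" "0 \<notin> E"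
    "\<And>e. e \<in> E \<Longrightarrow> \<exists>z. T u *v e = z *\<^sub>R (G u *v e)"
    "\<And>a b. a \<in> E \<Longrightarrow> b \<in> E \<Longrightarrow> a \<noteq> b \<Longrightarrow> a \<bullet> (G u *v b) = 0"
    using simultaneous_diagonalization[OF sym_G[OF u] pos_G[OF u] T_sym] by blast
  have T_orth: "x \<bullet> (T u *v e) = 0" if "x \<in> E" "e \<in> E" "x \<noteq> e" for x e
    using E(5)[OF that(2)] E(6)[OF that] by auto
  \<comment> \<open>The relative eigenvalue is nonzero by \<open>T_ker\<close>, and \<open>G\<close>
    is positive; this allows division by these values below.\<close>
  have T_nz: "e \<bullet> (T u *v e) \<noteq> 0" if "e \<in> E" for e
  proof -
    have "e \<noteq> 0" using E(4) that by auto
    moreover obtain z where "T u *v e = z *\<^sub>R (G u *v e)" using E(5)[OF \<open>e \<in> E\<close>] by blast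
    ultimately show ?thesis using T_ker[of e] pos_G[OF u, of e] by force
  qed
  have dA_0: "x \<bullet> (dA *v y) = 0" if xy: "x \<in> E" "y \<in> E" "x \<noteq> y" for x y
  proof -
    \<comment> \<open>A third basis vector \<open>e\<close> is \<open>T\<close>-orthogonal to
      \<open>x\<close> and \<open>y\<close>, so both \<open>M\<close> terms of \<open>eigen\<close>
      disappear.\<close>
    have "card (E - {x, y}) > 0" using xy E(1,2) dim by (simp add: card_Diff_subset)
    then have "E - {x, y} \<noteq> {}" by force
    then obtain e where e: "e \<in> E" "e \<noteq> x" "e \<noteq> y" by blast
    obtain z where "T u *v e = z *\<^sub>R (G u *v e)" using E(5)[OF e(1)] by blast
    from eigen[OF this, of x y] show ?thesis
      using T_nz[OF e(1)] T_orth[of x e] T_orth[of y e] xy e by simp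
  qed
  have M_0: "x \<bullet> (M *v y) = 0" if xy: "x \<in> E" "y \<in> E" "x \<noteq> y" for x y
  proof -
    \<comment> \<open>With \<open>e = y\<close> the \<open>dA\<close> term vanishes by
      \<open>dA_0\<close> and the last term by orthogonality; only the value of \<open>M\<close> at
      \<open>x\<close>, \<open>y\<close> is left.\<close>
    obtain z where "T u *v y = z *\<^sub>R (G u *v y)" using E(5)[OF xy(2)] by blast
    from eigen[OF this, of x y] show ?thesis
      using T_nz[OF xy(2)] T_orth[OF xy] dA_0[OF xy] by simp
  qed

  \<comment> \<open>The quadratic term of \<open>M\<close> is symmetric and cancels here, so
    \<open>W\<close> is the curl of \<open>a - b\<close>. Its diagonal values on \<open>E\<close>
    vanish by skewness, the others by \<open>dA_0\<close> and \<open>M_0\<close>.\<close>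
  define W where "W = dA - (M - transpose M)"
  have "transpose W = transpose dA - (transpose M - M)" by (simp add: W_def vec_eq_iff transpose_def)
  then have W_skew: "transpose W = - W" by (simp add: dA_skew W_def)
  have transpose_inner: "x \<bullet> (transpose N *v y) = y \<bullet> (N *v x)" for N :: "real^'n^'n" and x y
    by (metis dot_lmul_matrix inner_commute transpose_transpose vector_transpose_matrix)
  have W_0: "x \<bullet> (W *v y) = 0" if xy: "x \<in> E" "y \<in> E" for x y
  proof (cases "x = y")
    case True
    have "y \<bullet> (W *v y) = y \<bullet> ((- W) *v y)" using transpose_inner[of y W y] by (simp add: W_skew)
    also have "(- W) *v y = - (W *v y)" by (simp add: vec_eq_iff matrix_vector_mult_def sum_negf)
    finally show ?thesis using True by simp
  next
    case False
    have "x \<bullet> (transpose M *v y) = y \<bullet> (M *v x)" by (rule transpose_inner)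
    then show ?thesis using dA_0[OF xy False] M_0[OF xy False] M_0[OF xy(2,1)] False
      by (simp add: W_def matrix_vector_mult_diff_rdistrib inner_diff_right)
  qed
  have "bilinear (\<lambda>x y. x \<bullet> (W *v y))"
    by (auto simp: bilinear_def linear_iff inner_add_left inner_add_right
        matrix_vector_right_distrib matrix_vector_mult_scaleR)
  then have "x \<bullet> (W *v y) = 0" for x y
    using bilinear_eq[of "\<lambda>x y. x \<bullet> (W *v y)" "\<lambda>x y. 0" UNIV E UNIV E x y] W_0 E(3)
    by (simp add: bilinear_def linear_iff)
  from this[of "axis i 1" "axis k 1"] have "W $ i $ k = 0"
    by (simp add: inner_axis' matrix_vector_mult_basis column_def)
  moreover have "cov_deriv_covector G (\<lambda>v. a v - b v) u i k
      = cov_deriv_covector G a u i k - cov_deriv_covector G b u i k" for i k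
    using smooth_on_differentiable[OF open_S a u] smooth_on_differentiable[OF open_S b u]
    by (simp add: cov_deriv_covector_def partial_deriv_diff right_diff_distrib sum_subtractf)
  ultimately show ?thesis by (simp add: W_def dA_def M_def transpose_def)
qed

end


section \<open>Weakly Z symmetric manifolds\<close>

lemma covector_field_diff:
  fixes \<A> :: "('a, 'n::finite) chart set"
  assumes "\<And>U x. (U, x) \<in> \<A> \<Longrightarrow> open (x ` U)" "covector_field \<A> A" "covector_field \<A> B"
  shows "covector_field \<A> (\<lambda>c u. A c u - B c u)"
proof -
  have "smooth_on (x ` U) (\<lambda>u. (A (U, x) u - B (U, x) u) $ i)" if "(U, x) \<in> \<A>" for U x i
    unfolding vector_minus_component using assms that
    by (intro smooth_on_diff) (auto simp: covector_field_def)
  moreover have "A (V, y) (y p) $ j - B (V, y) (y p) $ j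
      = (\<Sum>a\<in>UNIV. jacobian (U, x) (V, y) p a j * (A (U, x) (x p) $ a - B (U, x) (x p) $ a))"
    if "(U, x) \<in> \<A>" "(V, y) \<in> \<A>" "p \<in> U" "p \<in> V" for U x V y p j
  proof -
    have "\<omega> (V, y) (y p) $ j = (\<Sum>a\<in>UNIV. jacobian (U, x) (V, y) p a j * \<omega> (U, x) (x p) $ a)"
      if "covector_field \<A> \<omega>" for \<omega>
      using that \<open>(U, x) \<in> \<A>\<close> \<open>(V, y) \<in> \<A>\<close> \<open>p \<in> U\<close> \<open>p \<in> V\<close> unfolding covector_field_def by fast
    from this[OF assms(2)] this[OF assms(3)] show ?thesis
      by (simp only: right_diff_distrib sum_subtractf)
  qed
  ultimately show ?thesis unfolding covector_field_def vector_minus_component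
    by fast
qed

theorem corollary4p12:
  fixes X :: "'a topology"
    and \<A> :: "('a, 'n::finite) chart set"
    and g :: "('a, 'n) chart \<Rightarrow> real^'n \<Rightarrow> real^'n^'n"
    and \<phi> :: "'a \<Rightarrow> real"
    and A B D \<Lambda> :: "('a, 'n) chart \<Rightarrow> real^'n \<Rightarrow> real^'n"
    and K :: "(real^'n \<Rightarrow> real^'n^'n) \<Rightarrow> real^'n \<Rightarrow> 'n \<Rightarrow> 'n \<Rightarrow> 'n \<Rightarrow> 'n \<Rightarrow> real"
  assumes "CARD('n) > 3"
    and "riemannian_manifold X \<A> g"
    and "weakly_Z_symmetric \<A> g \<phi> A B D"
    and "Z_nonsingular \<A> g \<phi>"
    and "K \<in> {conformal, projective, concircular, conharmonic}
             \<union> {quasi_conformal a b | a b. a \<noteq> 0 \<and> b \<noteq> 0}"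
    and "recurrent \<A> g K \<Lambda>"
    and "closed_1_form \<A> g \<Lambda>"
  shows "closed_1_form \<A> g (\<lambda>c u. A c u - B c u)"
proof -
  have atlas: "smooth_atlas X \<A>" "tensor_field_0_2 \<A> g"
    and metric: "\<forall>(U, x)\<in>\<A>. \<forall>u\<in>x ` U.
        transpose (g (U, x) u) = g (U, x) u \<and> (\<forall>v. v \<noteq> 0 \<longrightarrow> v \<bullet> (g (U, x) u *v v) > 0)"
    using assms(2) by (auto simp: riemannian_manifold_def smooth_manifold_def)
  have open_chart: "open (x ` U)" if "(U, x) \<in> \<A>" for U x
    using atlas(1) that by (auto simp: smooth_atlas_def)
  have fields: "scalar_field \<A> \<phi>" "covector_field \<A> A" "covector_field \<A> B"
    and weak: "\<forall>(U, x)\<in>\<A>. \<forall>u\<in>x ` U. \<forall>k j l.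
        cov_deriv_0_2 (g (U, x)) (Z_tensor g \<phi> (U, x)) u k j l =
          A (U, x) u $ k * Z_tensor g \<phi> (U, x) u $ j $ l
          + B (U, x) u $ j * Z_tensor g \<phi> (U, x) u $ k $ l
          + D (U, x) u $ l * Z_tensor g \<phi> (U, x) u $ k $ j"
    using assms(3) by (simp_all add: weakly_Z_symmetric_def)
  obtain Zi where Zi: "\<forall>(U, x)\<in>\<A>. \<forall>u\<in>x ` U. \<forall>h l.
       (\<Sum>k\<in>UNIV. Zi (U, x) u $ k $ h * Z_tensor g \<phi> (U, x) u $ k $ l) = kdelta h l"
    using assms(4) by (auto simp: Z_nonsingular_def)
  have "cov_deriv_covector (g (U, x)) (\<lambda>v. A (U, x) v - B (U, x) v) u i j
      - cov_deriv_covector (g (U, x)) (\<lambda>v. A (U, x) v - B (U, x) v) u j i = 0"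
    if c: "(U, x) \<in> \<A>" and u: "u \<in> x ` U" for U x u i j
  proof -
    let ?S = "x ` U" and ?G = "g (U, x)" and ?T = "Z_tensor g \<phi> (U, x)"
    interpret riemannian_chart ?S ?G
      using c open_chart[OF c] atlas(2) metric
      by unfold_locales (fastforce simp: tensor_field_0_2_def)+
    have T: "?T v $ j $ l = ricci ?G v $ j $ l + \<phi> (inv_into U x v) * ?G v $ j $ l" for v j l
      by (simp add: Z_tensor_def)
    have T_smooth: "smooth_on ?S (\<lambda>v. ?T v $ j $ l)" for j l
      unfolding T using fields(1) c
      by (intro smooth_on_add smooth_on_mult smooth_ricci smooth_G open_S) (auto simp: scalar_field_def)
    have T_commute: "?T v $ j $ l = ?T v $ l $ j" if "v \<in> ?S" for v j l
      unfolding T using ricci_commute[OF that] G_commute[OF that] by simp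
    have inv: "(\<Sum>k\<in>UNIV. Zi (U, x) v $ k $ h * ?T v $ k $ l) = kdelta h l" if "v \<in> ?S" for v h l
      using Zi c that by fast
    have pde: "cov_deriv_0_2 ?G ?T v k j l = A (U, x) v $ k * ?T v $ j $ l
        + B (U, x) v $ j * ?T v $ k $ l + D (U, x) v $ l * ?T v $ k $ j" if "v \<in> ?S" for v k j l
      using weak c that by fast
    \<comment> \<open>Since \<open>Z\<close> is symmetric, so is its covariant derivative in
      \<open>j\<close> and \<open>l\<close>; comparing both orders leaves a relation for
      \<open>B - D\<close> alone.\<close>
    have D_eq: "D (U, x) v = B (U, x) v" if v: "v \<in> ?S" for v
    proof -
      define F where "F = B (U, x) v - D (U, x) v"
      have dT: "partial_deriv k (\<lambda>v. ?T v $ j $ l) v = partial_deriv k (\<lambda>v. ?T v $ l $ j) v" for k j l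
        by (rule partial_deriv_cong[OF open_S v T_commute])
      have "cov_deriv_0_2 ?G ?T v k j l = cov_deriv_0_2 ?G ?T v k l j" for k j l
        by (simp add: cov_deriv_0_2_def dT[of k j l] T_commute[OF v, of _ l] T_commute[OF v, of _ j])
      then have F: "F $ j * ?T v $ k $ l = F $ l * ?T v $ k $ j" for k j l
        using pde[OF v, of k j l] pde[OF v, of k l j] T_commute[OF v, of j l]
        by (simp add: F_def algebra_simps)
      have "F $ j = 0" for j
      proof -
        have "card (UNIV - {j}) > 0" using assms(1) by (simp add: card_Diff_subset)
        then have "UNIV - {j} \<noteq> {}" by force
        then obtain l where "l \<noteq> j" by blast
        \<comment> \<open>Contraction with the inverse over \<open>k\<close> only, for fixed
          \<open>l \<noteq> j\<close>: one side becomes the component \<open>j\<close> of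
          \<open>F\<close>, the other zero.\<close>
        have "F $ j * kdelta l l = (\<Sum>k\<in>UNIV. Zi (U, x) v $ k $ l * (F $ j * ?T v $ k $ l))"
          by (simp add: sum_distrib_left ac_simps flip: inv[OF v])
        also have "\<dots> = F $ l * kdelta l j"
          unfolding F[of j _ l] by (simp add: sum_distrib_left ac_simps flip: inv[OF v])
        finally show ?thesis using \<open>l \<noteq> j\<close> by (simp add: kdelta_def)
      qed
      then show ?thesis by (simp add: F_def vec_eq_iff)
    qed
    \<comment> \<open>The transpose of \<open>Zi\<close> is a left inverse of
      \<open>Z\<close>.\<close>
    have T_ker: "w = 0" if "?T u *v w = 0" for w
    proof -
      have "w $ h = 0" for h
      proof -
        have "w $ h = (\<Sum>l\<in>UNIV. kdelta h l * w $ l)"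
          by (simp add: kdelta_def if_distrib[of "\<lambda>z. z * _"] cong: if_cong)
        also have "\<dots> = (\<Sum>k\<in>UNIV. Zi (U, x) u $ k $ h * (?T u *v w) $ k)"
          unfolding inv[OF u, symmetric] sum_distrib_right
          by (subst sum.swap) (simp add: matrix_vector_mult_def sum_distrib_left ac_simps)
        finally show ?thesis using that by simp
      qed
      then show ?thesis by (simp add: vec_eq_iff)
    qed
    show ?thesis
    proof (rule weakly_symmetric_difference_closed[OF u _ T_smooth T_commute T_ker])
      show "CARD('n) \<ge> 3" using assms(1) by simp
      show "smooth_on ?S (\<lambda>v. A (U, x) v $ j)" "smooth_on ?S (\<lambda>v. B (U, x) v $ j)" for j
        using fields(2,3) c by (auto simp: covector_field_def)
    qed (use pde D_eq in auto)
  qed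
  then show ?thesis
    using covector_field_diff[OF open_chart fields(2,3)] by (auto simp: closed_1_form_def)
qed

end
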